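(* Let $n \geq 5$ be an integer. Then there exists a compact set $\Omega_2 \subset \mathbb{R}^n$ of positive Lebesgue measure such that $L^2(\Omega_2)$ admits an orthonormal basis of exponentials $\{ \frac{1}{|\Omega_2|^{1/2}} e^{2\pi i \xi_j \cdot x} : \xi_j \in \Lambda_2 \}$ for some $\Lambda_2 \subset \mathbb{R}^n$, but such that $\Omega_2$ does not tile $\mathbb{R}^n$ by translations. In particular, Fuglede's conjecture is false in $\mathbb{R}^n$ for $n \geq 5$.
   Context: $|\Omega|$ denotes the Lebesgue measure of $\Omega$, and $\xi \cdot x$ is the standard dot product on $\mathbb{R}^n$. $L^2(\Omega)$ is the Hilbert space of complex-valued square-integrable functions on $\Omega$ with respect to Lebesgue measure, and the exponentials are regarded as functions of $x \in \Omega$. A set $\Omega \subset \mathbb{R}^n$ tiles $\mathbb{R}^n$ by translations if there is a set $\Sigma \subset \mathbb{R}^n$ such that the translates $\{t + \Omega : t \in \Sigma\}$ partition $\mathbb{R}^n$ ignoring sets of measure zero (i.e. distinct translates overlap only in sets of measure zero, and the translates cover $\mathbb{R}^n$ up to a set of measure zero). A domain in $\mathbb{R}^n$ is a Lebesgue measurable subset $\Omega \subset \mathbb{R}^n$ with finite non-zero Lebesgue measure. A set $\Lambda \subset \mathbb{R}^n$ is a spectrum of a domain $\Omega$ if $\{\frac{1}{|\Omega|^{1/2}} e^{2\pi i x \cdot \xi}\}_{\xi \in \Lambda}$ is an orthonormal basis of $L^2(\Omega)$. Fuglede's conjecture in $\mathbb{R}^n$ is the assertion that a domain $\Omega \subset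 \mathbb{R}^n$ admits a spectrum if and only if it is possible to tile $\mathbb{R}^n$ by a family of translates of $\Omega$ (ignoring sets of measure zero). *)

theory Defs
  imports "HOL-Analysis.Analysis"
begin

text \<open>The elements of \<open>L\<^sup>2(M)\<close> are represented by functions rather than by classes of functions
  modulo null sets; the notions below only depend on the classes.\<close>

definition L2_space :: "'a measure \<Rightarrow> ('a \<Rightarrow> complex) set" where
  "L2_space M = {f \<in> borel_measurable M. integrable M (\<lambda>x. (cmod (f x))\<^sup>2)}"

definition L2_inner :: "'a measure \<Rightarrow> ('a \<Rightarrow> complex) \<Rightarrow> ('a \<Rightarrow> complex) \<Rightarrow> complex" where
  "L2_inner M f g = (LINT x|M. f x * cnj (g x))"

definition L2_norm :: "'a measure \<Rightarrow> ('a \<Rightarrow> complex) \<Rightarrow> real" where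
  "L2_norm M f = sqrt (LINT x|M. (cmod (f x))\<^sup>2)"

text \<open>An orthonormal family whose finite linear combinations are dense in \<open>L\<^sup>2(M)\<close>.\<close>

definition L2_orthonormal_basis :: "'a measure \<Rightarrow> 'i set \<Rightarrow> ('i \<Rightarrow> 'a \<Rightarrow> complex) \<Rightarrow> bool" where
  "L2_orthonormal_basis M I e \<longleftrightarrow>
     (\<forall>i\<in>I. e i \<in> L2_space M) \<and>
     (\<forall>i\<in>I. \<forall>j\<in>I. L2_inner M (e i) (e j) = (if i = j then 1 else 0)) \<and>
     (\<forall>f\<in>L2_space M. \<forall>\<epsilon>>0. \<exists>F c. finite F \<and> F \<subseteq> I \<and>
        L2_norm M (\<lambda>x. f x - (\<Sum>i\<in>F. c i * e i x)) < \<epsilon>)"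

definition fuglede_domain :: "(real ^ 'n) set \<Rightarrow> bool" where
  "fuglede_domain \<Omega> \<longleftrightarrow> \<Omega> \<in> lmeasurable \<and> measure lebesgue \<Omega> \<noteq> 0"

definition is_spectrum :: "(real ^ 'n) set \<Rightarrow> (real ^ 'n) set \<Rightarrow> bool" where
  "is_spectrum \<Lambda> \<Omega> \<longleftrightarrow>
     L2_orthonormal_basis (lebesgue_on \<Omega>) \<Lambda>
       (\<lambda>\<xi> x. 1 / complex_of_real (sqrt (measure lebesgue \<Omega>))
                * exp (2 * complex_of_real pi * \<i> * complex_of_real (\<xi> \<bullet> x)))"

definition tiles_by_translations :: "(real ^ 'n) set \<Rightarrow> bool" where
  "tiles_by_translations \<Omega> \<longleftrightarrow>
     (\<exists>T. pairwise (\<lambda>A B. negligible (A \<inter> B)) ((\<lambda>t. (+) t ` \<Omega>) ` T) \<and>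
          negligible (- (\<Union>t\<in>T. (+) t ` \<Omega>)))"

definition fuglede_conjecture :: "'n::finite itself \<Rightarrow> bool" where
  "fuglede_conjecture _ \<longleftrightarrow>
     (\<forall>\<Omega>::(real ^ 'n) set. fuglede_domain \<Omega> \<longrightarrow>
        ((\<exists>\<Lambda>. is_spectrum \<Lambda> \<Omega>) \<longleftrightarrow> tiles_by_translations \<Omega>))"

end

theory Submission
  imports Defs
begin

text \<open>
Let \<open>n = CARD('n)\<close>. The starting point is a finite phenomenon. A \<open>6 \<times> 6\<close> complex Hadamard matrix whose
entries are third roots of unity (\<open>butson6\<close>) says that the six points \<open>0, e\<^sub>1, \<dots>, e\<^sub>5\<close> of the group
\<open>(\<int>/3)\<^sup>n\<close> have an orthogonal basis of characters. They do not tile this group, as 6 does not divide \<open>3\<^sup>n\<close>.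
Five dimensions suffice because the matrix can be normalised to have a constant column, which
corresponds to the origin.

To reach \<open>\<real>\<^sup>n\<close>, the six points are lifted to the lattice \<open>\<int>\<^sup>n\<close> and then to unit cubes. The bare lift would
not do: the six points tile \<open>\<int>\<^sup>n\<close>, being a transversal of the kernel of a homomorphism onto \<open>\<int>/6\<close>. So
the points are first thickened by \<open>3 \<cdot> {0, \<dots>, M - 1}\<^sup>n\<close> for large \<open>M\<close> (\<open>thick_simplex\<close>). This
keeps the set spectral (\<open>spectral_thick_simplex\<close>), with each of the six frequencies refined by the dual
box \<open>{0, \<dots>, M - 1}\<^sup>n / (3 M)\<close>. It also forces any tiling of the lattice to be 3-periodic around some
block of side 3: at most \<open>6\<^sup>n\<close> of the translated boxes \<open>3 \<cdot> {0, \<dots>, M - 1}\<^sup>n\<close> can meet a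
box of side \<open>3 M\<close>, so that for \<open>M = 6\<^sup>n\<close> the pigeonhole principle finds a block away from all
their ends. There the tiling would be one of \<open>(\<int>/3)\<^sup>n\<close>, which is impossible (\<open>no_lattice_tiling_thick_simplex\<close>).

Both properties pass from a finite set \<open>A\<close> of lattice points to the union of the unit cubes at \<open>A\<close>. A
tiling of space restricts to a tiling of the lattice on a generic coset (\<open>lattice_tiling_of_tiling\<close>).
A spectrum of \<open>A\<close>, together with all its translates by integral vectors, is a spectrum of the union
(\<open>is_spectrum_cube_union\<close>); this rests on the completeness of the trigonometric polynomials on the unit
cube (\<open>trig_poly_dense_L2_cube\<close>), proved from the Stone-Weierstrass theorem on the torus.
\<close>

section \<open>Characters of the unit cube\<close>

definition unit_cube :: "(real ^ 'n::finite) set" where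
  "unit_cube = cbox 0 1"

definition character :: "real ^ 'n::finite \<Rightarrow> real ^ 'n \<Rightarrow> complex" where
  "character \<xi> x = cis (2 * pi * (\<xi> \<bullet> x))"

definition int_vec :: "int ^ 'n::finite \<Rightarrow> real ^ 'n" where
  "int_vec k = (\<chi> i. of_int (k $ i))"

lemma int_vec_nth [simp]: "int_vec k $ i = of_int (k $ i)"
  by (simp add: int_vec_def)

lemma int_vec_add: "int_vec (a + b) = int_vec a + int_vec b"
  and int_vec_diff: "int_vec (a - b) = int_vec a - int_vec b"
  and int_vec_0 [simp]: "int_vec 0 = 0"
  by (simp_all add: vec_eq_iff)

lemma int_vec_inject [simp]: "int_vec a = int_vec b \<longleftrightarrow> a = b"
  by (simp add: vec_eq_iff)

lemma character_add_left: "character (\<xi> + \<eta>) x = character \<xi> x * character \<eta> x"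
  by (simp add: character_def cis_mult inner_add_left ring_distribs)

lemma character_add_right: "character \<xi> (x + y) = character \<xi> x * character \<xi> y"
  by (simp add: character_def cis_mult inner_add_right ring_distribs)

lemma character_diff_left: "character (\<xi> - \<eta>) x = character \<xi> x * cnj (character \<eta> x)"
  by (simp add: character_def cis_mult cis_cnj inner_diff_left ring_distribs)

lemma character_diff_right: "character \<xi> (x - y) = character \<xi> x * cnj (character \<xi> y)"
  by (simp add: character_def cis_mult cis_cnj inner_diff_right ring_distribs)

lemma character_0 [simp]: "character 0 x = 1" "character \<xi> 0 = 1"
  by (simp_all add: character_def)

lemma norm_character [simp]: "cmod (character \<xi> x) = 1"
  by (simp add: character_def)

lemma character_mult_cnj [simp]: "character \<xi> x * cnj (character \<xi> x) = 1"
  "cnj (character \<xi> x) * character \<xi> x = 1"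
  by (simp_all add: character_def cis_cnj cis_mult)

lemma continuous_character: "continuous_on S (character \<xi>)"
  unfolding character_def [abs_def] by (intro continuous_intros)

lemma character_measurable [measurable]: "character \<xi> \<in> borel_measurable borel"
  by (rule borel_measurable_continuous_onI[OF continuous_character])

lemma character_prod:
  fixes \<xi> x :: "real ^ 'n::finite"
  shows "character \<xi> x = (\<Prod>i\<in>UNIV. cis (2 * pi * (\<xi> $ i * x $ i)))"
proof -
  have "cis (sum f I) = (\<Prod>i\<in>I. cis (f i))" if "finite I" for f :: "'n \<Rightarrow> real" and I
    using that by (induction I) (auto simp: cis_mult[symmetric])
  then have "cis (\<Sum>i\<in>UNIV. 2 * pi * (\<xi> $ i * x $ i)) = (\<Prod>i\<in>UNIV. cis (2 * pi * (\<xi> $ i * x $ i)))"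
    by simp
  then show ?thesis
    by (simp only: character_def inner_vec_def sum_distrib_left inner_real_def)
qed

lemma cis_2pi_int: "cis (2 * pi * of_int n) = 1"
  by (simp add: cis_multiple_2pi)

lemma character_int_vec: "character (int_vec k) (int_vec a) = 1"
proof -
  have "int_vec k \<bullet> int_vec a = of_int (\<Sum>i\<in>UNIV. k $ i * a $ i)"
    by (simp add: inner_vec_def)
  then show ?thesis by (simp only: character_def cis_2pi_int)
qed

text \<open>The Lebesgue measure on \<open>real ^ 'n\<close> is by definition the image of a product measure indexed by the
standard basis; identifying basis vectors with coordinates turns the product theorem into Fubini's
theorem for functions with separated variables.\<close>

lemma lborel_vec_integral_prod:
  fixes f :: "'n::finite \<Rightarrow> real \<Rightarrow> complex"
  assumes int: "\<And>i. integrable lborel (f i)"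
  shows "(LINT x|lborel. (\<Prod>i\<in>UNIV. f i ((x :: real ^ 'n) $ i))) = (\<Prod>i\<in>UNIV. (LINT t|lborel. f i t))"
proof -
  define ix :: "real ^ 'n \<Rightarrow> 'n" where "ix = inv (\<lambda>i. axis i 1)"
  have inj: "inj (\<lambda>i::'n. axis i (1::real))"
    by (auto simp: inj_on_def axis_eq_axis)
  have ix [simp]: "ix (axis i 1) = i" for i
    unfolding ix_def using inj by (rule inv_f_f)
  have Basis: "(Basis :: (real ^ 'n) set) = range (\<lambda>i. axis i 1)"
    by (auto simp: Basis_vec_def)
  have reindex: "(\<Prod>b\<in>Basis. g b) = (\<Prod>i\<in>UNIV. g (axis i 1))" for g :: "real ^ 'n \<Rightarrow> complex"
    unfolding Basis by (subst prod.reindex[OF inj]) simp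
  interpret product_sigma_finite "\<lambda>b :: real ^ 'n. lborel :: real measure"
    by standard
  have [measurable]: "f i \<in> borel_measurable borel" for i
    using borel_measurable_integrable[OF int[of i]] by simp
  have "(LINT x|lborel. (\<Prod>i\<in>UNIV. f i ((x :: real ^ 'n) $ i))) =
        (LINT y|(\<Pi>\<^sub>M b\<in>Basis. lborel). (\<Prod>b\<in>Basis. f (ix b) (y b)))"
  proof (subst lborel_eq, subst integral_distr)
    show "(LINT y|(\<Pi>\<^sub>M b\<in>Basis. lborel). (\<Prod>i\<in>UNIV. f i ((\<Sum>b\<in>Basis. y b *\<^sub>R b :: real ^ 'n) $ i))) =
          (LINT y|(\<Pi>\<^sub>M b\<in>Basis. lborel). (\<Prod>b\<in>Basis. f (ix b) (y b)))"
    proof (intro arg_cong[where f="integral\<^sup>L _"] ext)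
      fix y :: "real ^ 'n \<Rightarrow> real"
      have "(\<Sum>b\<in>Basis. y b *\<^sub>R b :: real ^ 'n) $ i = y (axis i 1)" for i
      proof -
        have "(\<Sum>b\<in>Basis. y b *\<^sub>R b :: real ^ 'n) $ i = (\<Sum>b\<in>Basis. y b *\<^sub>R b) \<bullet> axis i 1"
          by (simp add: inner_axis)
        also have "\<dots> = y (axis i 1)"
          by (subst inner_sum_left_Basis) (auto simp: Basis)
        finally show ?thesis .
      qed
      then show "(\<Prod>i\<in>UNIV. f i ((\<Sum>b\<in>Basis. y b *\<^sub>R b :: real ^ 'n) $ i)) = (\<Prod>b\<in>Basis. f (ix b) (y b))"
        by (simp add: reindex)
    qed
  qed measurable
  also have "\<dots> = (\<Prod>b\<in>Basis. (LINT t|lborel. f (ix b) t))"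
    by (intro product_integral_prod int) simp
  finally show ?thesis by (simp add: reindex)
qed

lemma integral_cis_unit_interval:
  fixes k :: int
  shows "has_bochner_integral lborel (\<lambda>t. indicator {0..1} t *\<^sub>R cis (2 * pi * (k * t))) (if k = 0 then 1 else 0)"
proof (cases "k = 0")
  case True
  have "has_bochner_integral lborel (\<lambda>t::real. indicator {0..1} t *\<^sub>R (1::complex)) (measure lborel {0..1::real} *\<^sub>R 1)"
    by (intro has_bochner_integral_scaleR_left has_bochner_integral_real_indicator) auto
  then show ?thesis using True by simp
next
  case False
  define F where "F t = cis (2 * pi * (k * t)) / (2 * pi * k * \<i>)" for t :: real
  have nz: "complex_of_real (2 * pi * k) * \<i> \<noteq> 0" using False by simp
  have "has_bochner_integral lborel (\<lambda>t. indicator {0..1} t *\<^sub>R cis (2 * pi * (k * t))) (F 1 - F 0)"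
  proof (rule has_bochner_integral_FTC_Icc)
    show "continuous_on {0..1} (\<lambda>t::real. cis (2 * pi * (k * t)))"
      by (intro continuous_intros)
    fix t :: real
    have "((\<lambda>t. exp (\<i> * of_real (2 * pi * (k * t))) / (2 * pi * k * \<i>)) has_vector_derivative
            exp (\<i> * of_real (2 * pi * (k * t)))) (at t within {0..1})"
      by (rule has_vector_derivative_real_field | (rule derivative_eq_intros refl | simp add: False)+)+
    then show "(F has_vector_derivative cis (2 * pi * (k * t))) (at t within {0..1})"
      by (simp add: F_def [abs_def] cis_conv_exp)
  qed simp
  moreover have "F 1 = F 0" using cis_2pi_int[of k] by (simp add: F_def)
  ultimately show ?thesis using False by simp
qed

lemma indicator_unit_cube:
  "indicator (unit_cube :: (real ^ 'n::finite) set) x = (\<Prod>i\<in>UNIV. indicator {0..1} (x $ i) :: real)"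
  by (auto simp: unit_cube_def indicator_def mem_box_cart prod_zero_iff)

lemma unit_cube_measurable [measurable]: "unit_cube \<in> sets borel"
  by (simp add: unit_cube_def)

lemma unit_cube_lebesgue [simp]: "unit_cube \<in> sets lebesgue"
  by (simp add: unit_cube_def)

text \<open>The integral of an integral character factors over the coordinates, and a coordinate with non-zero
frequency contributes an integral of \<open>cis\<close> over full periods, which vanishes.\<close>

lemma character_integral_unit_cube:
  fixes k :: "int ^ 'n::finite"
  shows "(LINT x|lebesgue_on unit_cube. character (int_vec k) x) = (if k = 0 then 1 else 0)"
proof -
  have "(LINT x|lebesgue_on unit_cube. character (int_vec k) x) =
        (LINT x|lebesgue. indicator unit_cube x *\<^sub>R character (int_vec k) x)"
    by (intro integral_restrict_space) simp
  also have "\<dots> = (LINT x|lborel. indicator unit_cube x *\<^sub>R character (int_vec k) x)"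
    by (rule integral_completion) measurable
  also have "\<dots> = (LINT x|lborel. (\<Prod>i\<in>UNIV. indicator {0..1} ((x :: real ^ 'n) $ i) *\<^sub>R cis (2 * pi * (of_int (k $ i) * x $ i))))"
    by (simp add: indicator_unit_cube character_prod scaleR_conv_of_real prod.distrib)
  also have "\<dots> = (\<Prod>i\<in>UNIV. if k $ i = 0 then 1 else 0)"
    using integral_cis_unit_interval
    by (subst lborel_vec_integral_prod) (auto simp: has_bochner_integral_iff)
  also have "\<dots> = (if k = 0 then 1 else 0)"
    by (auto simp: vec_eq_iff)
  finally show ?thesis .
qed

section \<open>Closures in the space of square-integrable functions\<close>

text \<open>Distances are squared so that the elementary bound \<open>cmod_add_sq_le\<close>, at the cost of a factor 2, can
serve as the triangle inequality.\<close>

definition L2_dist_sq :: "'a measure \<Rightarrow> ('a \<Rightarrow> complex) \<Rightarrow> ('a \<Rightarrow> complex) \<Rightarrow> real" where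
  "L2_dist_sq M f g = (LINT x|M. (cmod (f x - g x))\<^sup>2)"

lemma cmod_add_sq_le: "(cmod (a + b))\<^sup>2 \<le> 2 * (cmod a)\<^sup>2 + 2 * (cmod b)\<^sup>2"
proof -
  have "(cmod (a + b))\<^sup>2 \<le> (cmod a + cmod b)\<^sup>2"
    by (intro power_mono norm_triangle_ineq) auto
  also have "\<dots> \<le> 2 * (cmod a)\<^sup>2 + 2 * (cmod b)\<^sup>2"
    using sum_squares_bound[of "cmod a" "cmod b"] by (simp add: power2_sum)
  finally show ?thesis .
qed

lemma L2_space_add:
  assumes "f \<in> L2_space M" "g \<in> L2_space M"
  shows "(\<lambda>x. f x + g x) \<in> L2_space M"
proof -
  have [measurable]: "f \<in> borel_measurable M" "g \<in> borel_measurable M"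
    using assms by (auto simp: L2_space_def)
  have "integrable M (\<lambda>x. 2 * (cmod (f x))\<^sup>2 + 2 * (cmod (g x))\<^sup>2)"
    using assms by (auto simp: L2_space_def)
  then have "integrable M (\<lambda>x. (cmod (f x + g x))\<^sup>2)"
    by (rule Bochner_Integration.integrable_bound) (auto intro!: AE_I2 cmod_add_sq_le)
  then show ?thesis by (simp add: L2_space_def)
qed

lemma L2_space_scale: "f \<in> L2_space M \<Longrightarrow> (\<lambda>x. c * f x) \<in> L2_space M"
  by (auto simp: L2_space_def norm_mult power_mult_distrib)

lemma L2_space_diff:
  assumes "f \<in> L2_space M" "g \<in> L2_space M"
  shows "(\<lambda>x. f x - g x) \<in> L2_space M"
  using L2_space_add[OF assms(1) L2_space_scale[OF assms(2), of "-1"]] by simp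

lemma L2_space_sum: "(\<And>i. i \<in> I \<Longrightarrow> f i \<in> L2_space M) \<Longrightarrow> (\<lambda>x. \<Sum>i\<in>I. f i x) \<in> L2_space M"
  by (induction I rule: infinite_finite_induct) (simp_all add: L2_space_add, simp_all add: L2_space_def)

lemma (in finite_measure) L2_space_bounded:
  assumes [measurable]: "f \<in> borel_measurable M" and "\<And>x. x \<in> space M \<Longrightarrow> cmod (f x) \<le> B"
  shows "f \<in> L2_space M"
  unfolding L2_space_def
  using assms by (auto intro!: integrable_const_bound[where B="B\<^sup>2"] AE_I2 power_mono)

lemma L2_dist_sq_le:
  assumes "f \<in> L2_space M" "g \<in> L2_space M" "h \<in> L2_space M" "k \<in> L2_space M"
  shows "L2_dist_sq M (\<lambda>x. f x + g x) (\<lambda>x. h x + k x) \<le> 2 * L2_dist_sq M f h + 2 * L2_dist_sq M g k"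
proof -
  note D = L2_space_diff[OF assms(1,3)] L2_space_diff[OF assms(2,4)]
  have int: "integrable M (\<lambda>x. (cmod (f x - h x))\<^sup>2)" "integrable M (\<lambda>x. (cmod (g x - k x))\<^sup>2)"
    using D by (simp_all add: L2_space_def)
  have int': "integrable M (\<lambda>x. (cmod (f x + g x - (h x + k x)))\<^sup>2)"
    using L2_space_diff[OF L2_space_add[OF assms(1,2)] L2_space_add[OF assms(3,4)]]
    by (simp add: L2_space_def)
  have "L2_dist_sq M (\<lambda>x. f x + g x) (\<lambda>x. h x + k x) \<le>
        (LINT x|M. 2 * (cmod (f x - h x))\<^sup>2 + 2 * (cmod (g x - k x))\<^sup>2)"
    unfolding L2_dist_sq_def
  proof (rule integral_mono)
    show "integrable M (\<lambda>x. (cmod (f x + g x - (h x + k x)))\<^sup>2)"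
      by (fact int')
    show "integrable M (\<lambda>x. 2 * (cmod (f x - h x))\<^sup>2 + 2 * (cmod (g x - k x))\<^sup>2)"
      using int by auto
    show "(cmod (f x + g x - (h x + k x)))\<^sup>2 \<le> 2 * (cmod (f x - h x))\<^sup>2 + 2 * (cmod (g x - k x))\<^sup>2" for x
      using cmod_add_sq_le[of "f x - h x" "g x - k x"] by (simp add: algebra_simps)
  qed
  also have "\<dots> = 2 * L2_dist_sq M f h + 2 * L2_dist_sq M g k"
    using int by (simp add: L2_dist_sq_def)
  finally show ?thesis .
qed

definition L2_closure :: "'a measure \<Rightarrow> ('a \<Rightarrow> complex) set \<Rightarrow> ('a \<Rightarrow> complex) set" where
  "L2_closure M V = {f \<in> L2_space M. \<forall>\<epsilon>>0. \<exists>v\<in>V. L2_dist_sq M f v < \<epsilon>}"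

text \<open>An \<open>L\<^sup>2\<close> function over a restricted measure may take any values outside the space of the measure,
so membership in a closure has to be insensitive to them.\<close>

lemma L2_closure_cong:
  assumes "f \<in> L2_closure M V" "\<And>x. x \<in> space M \<Longrightarrow> f x = g x"
  shows "g \<in> L2_closure M V"
proof -
  have "L2_dist_sq M f v = L2_dist_sq M g v" for v
    unfolding L2_dist_sq_def using assms(2) by (intro Bochner_Integration.integral_cong) auto
  moreover have "f \<in> borel_measurable M \<longleftrightarrow> g \<in> borel_measurable M"
    using assms(2) by (rule measurable_cong)
  moreover have "integrable M (\<lambda>x. (cmod (f x))\<^sup>2) \<longleftrightarrow> integrable M (\<lambda>x. (cmod (g x))\<^sup>2)"
    using assms(2) by (intro Bochner_Integration.integrable_cong) auto
  ultimately show ?thesis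
    using assms(1) by (simp add: L2_closure_def L2_space_def)
qed

lemma L2_closure_add:
  assumes V: "V \<subseteq> L2_space M" "\<And>v w. v \<in> V \<Longrightarrow> w \<in> V \<Longrightarrow> (\<lambda>x. v x + w x) \<in> V"
    and fg: "f \<in> L2_closure M V" "g \<in> L2_closure M V"
  shows "(\<lambda>x. f x + g x) \<in> L2_closure M V"
  unfolding L2_closure_def
proof (intro CollectI conjI allI impI)
  show "(\<lambda>x. f x + g x) \<in> L2_space M"
    using fg by (auto simp: L2_closure_def intro: L2_space_add)
  fix \<epsilon> :: real assume "\<epsilon> > 0"
  then have "\<epsilon> / 4 > 0" by simp
  then have "\<exists>v\<in>V. L2_dist_sq M f v < \<epsilon> / 4" "\<exists>w\<in>V. L2_dist_sq M g w < \<epsilon> / 4"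
    using fg unfolding L2_closure_def by blast+
  then obtain v w where vw: "v \<in> V" "w \<in> V" "L2_dist_sq M f v < \<epsilon> / 4" "L2_dist_sq M g w < \<epsilon> / 4"
    by blast
  have "L2_dist_sq M (\<lambda>x. f x + g x) (\<lambda>x. v x + w x) \<le> 2 * L2_dist_sq M f v + 2 * L2_dist_sq M g w"
    using fg vw V(1) by (intro L2_dist_sq_le) (auto simp: L2_closure_def)
  also have "\<dots> < \<epsilon>" using vw by simp
  finally show "\<exists>v\<in>V. L2_dist_sq M (\<lambda>x. f x + g x) v < \<epsilon>"
    using V(2)[OF vw(1,2)] by blast
qed

lemma L2_closure_scale:
  assumes V: "\<And>c v. v \<in> V \<Longrightarrow> (\<lambda>x. c * v x) \<in> V" and f: "f \<in> L2_closure M V"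
  shows "(\<lambda>x. c * f x) \<in> L2_closure M V"
  unfolding L2_closure_def
proof (intro CollectI conjI allI impI)
  show "(\<lambda>x. c * f x) \<in> L2_space M"
    using f by (auto simp: L2_closure_def intro: L2_space_scale)
  fix \<epsilon> :: real assume "\<epsilon> > 0"
  define \<delta> where "\<delta> = \<epsilon> / (1 + (cmod c)\<^sup>2)"
  have pos: "1 + (cmod c)\<^sup>2 > 0" by (simp add: add_pos_nonneg)
  then have "\<delta> > 0" using \<open>\<epsilon> > 0\<close> by (simp add: \<delta>_def)
  then obtain v where v: "v \<in> V" "L2_dist_sq M f v < \<delta>"
    using f by (auto simp: L2_closure_def)
  have "L2_dist_sq M (\<lambda>x. c * f x) (\<lambda>x. c * v x) = (cmod c)\<^sup>2 * L2_dist_sq M f v"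
    by (simp add: L2_dist_sq_def right_diff_distrib[symmetric] norm_mult power_mult_distrib)
  also have "\<dots> \<le> (cmod c)\<^sup>2 * \<delta>"
    using v by (intro mult_left_mono) auto
  also have "\<dots> < (1 + (cmod c)\<^sup>2) * \<delta>"
    using \<open>\<delta> > 0\<close> by (simp add: algebra_simps)
  also have "\<dots> = \<epsilon>" using pos by (simp add: \<delta>_def)
  finally show "\<exists>v\<in>V. L2_dist_sq M (\<lambda>x. c * f x) v < \<epsilon>"
    using V[OF v(1)] by blast
qed

lemma L2_closure_sum:
  assumes V: "V \<subseteq> L2_space M" "\<And>v w. v \<in> V \<Longrightarrow> w \<in> V \<Longrightarrow> (\<lambda>x. v x + w x) \<in> V" "(\<lambda>_. 0) \<in> V"
    and f: "\<And>i. i \<in> I \<Longrightarrow> f i \<in> L2_closure M V"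
  shows "(\<lambda>x. \<Sum>i\<in>I. f i x) \<in> L2_closure M V"
proof -
  have 0: "(\<lambda>_. 0) \<in> L2_closure M V"
    using V by (auto simp: L2_closure_def L2_dist_sq_def intro!: bexI[OF _ V(3)])
  show ?thesis
    using f by (induction I rule: infinite_finite_induct) (simp_all add: 0 L2_closure_add[OF V(1,2)])
qed

lemma L2_closure_closed:
  assumes V: "V \<subseteq> L2_space M" and f: "f \<in> L2_space M"
    and approx: "\<And>\<epsilon>. \<epsilon> > 0 \<Longrightarrow> \<exists>g\<in>L2_closure M V. L2_dist_sq M f g < \<epsilon>"
  shows "f \<in> L2_closure M V"
  unfolding L2_closure_def
proof (intro CollectI conjI allI impI)
  fix \<epsilon> :: real assume "\<epsilon> > 0"
  then have \<epsilon>: "\<epsilon> / 4 > 0" by simp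
  then obtain g where g: "g \<in> L2_closure M V" "L2_dist_sq M f g < \<epsilon> / 4"
    using approx by blast
  have "\<exists>v\<in>V. L2_dist_sq M g v < \<epsilon> / 4"
    using g(1) \<epsilon> unfolding L2_closure_def by blast
  then obtain v where v: "v \<in> V" "L2_dist_sq M g v < \<epsilon> / 4"
    by blast
  have mem: "g \<in> L2_space M" "v \<in> L2_space M" "(\<lambda>x. f x - g x) \<in> L2_space M"
    using g v V f by (auto simp: L2_closure_def intro: L2_space_diff)
  have 0: "(\<lambda>_. 0) \<in> L2_space M" by (simp add: L2_space_def)
  have "L2_dist_sq M (\<lambda>x. (f x - g x) + g x) (\<lambda>x. 0 + v x) \<le>
        2 * L2_dist_sq M (\<lambda>x. f x - g x) (\<lambda>_. 0) + 2 * L2_dist_sq M g v"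
    by (intro L2_dist_sq_le mem 0)
  also have "L2_dist_sq M (\<lambda>x. f x - g x) (\<lambda>_. 0) = L2_dist_sq M f g"
    by (simp add: L2_dist_sq_def)
  finally have "L2_dist_sq M f v < \<epsilon>" using g v by simp
  then show "\<exists>v\<in>V. L2_dist_sq M f v < \<epsilon>" using v by blast
qed (fact f)

section \<open>Trigonometric polynomials\<close>

text \<open>The linear span of the characters with frequencies in \<open>\<Lambda>\<close>. The inductive form gives the closure
properties by induction; \<open>char_span_explicit\<close> recovers finite linear combinations. Functions in
\<open>char_span (range int_vec)\<close> are the trigonometric polynomials with the integer lattice as a
lattice of periods.\<close>

inductive_set char_span :: "(real ^ 'n::finite) set \<Rightarrow> (real ^ 'n \<Rightarrow> complex) set"
  for \<Lambda> where
  zero: "(\<lambda>_. 0) \<in> char_span \<Lambda>"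
| add: "\<xi> \<in> \<Lambda> \<Longrightarrow> g \<in> char_span \<Lambda> \<Longrightarrow> (\<lambda>x. c * character \<xi> x + g x) \<in> char_span \<Lambda>"

lemma char_span_character: "\<xi> \<in> \<Lambda> \<Longrightarrow> (\<lambda>x. c * character \<xi> x) \<in> char_span \<Lambda>"
  using char_span.add[OF _ char_span.zero, of \<xi> \<Lambda> c] by simp

lemma char_span_add: "f \<in> char_span \<Lambda> \<Longrightarrow> g \<in> char_span \<Lambda> \<Longrightarrow> (\<lambda>x. f x + g x) \<in> char_span \<Lambda>"
  by (induction rule: char_span.induct) (auto simp: add.assoc intro: char_span.add)

lemma char_span_scale: "f \<in> char_span \<Lambda> \<Longrightarrow> (\<lambda>x. c * f x) \<in> char_span \<Lambda>"
proof (induction rule: char_span.induct)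
  case (add \<xi> g d)
  then show ?case
    using char_span.add[of \<xi> \<Lambda> "\<lambda>x. c * g x" "c * d"] by (simp add: algebra_simps)
qed (simp add: char_span.zero)

lemma char_span_sum: "(\<And>i. i \<in> I \<Longrightarrow> f i \<in> char_span \<Lambda>) \<Longrightarrow> (\<lambda>x. \<Sum>i\<in>I. f i x) \<in> char_span \<Lambda>"
  by (induction I rule: infinite_finite_induct) (simp_all add: char_span.zero char_span_add)

lemma char_span_shift:
  assumes "f \<in> char_span \<Lambda>" "\<And>\<xi>. \<xi> \<in> \<Lambda> \<Longrightarrow> \<xi> + \<beta> \<in> \<Lambda>'"
  shows "(\<lambda>x. f x * character \<beta> x) \<in> char_span \<Lambda>'"
  using assms(1)
proof (induction rule: char_span.induct)
  case (add \<xi> g c)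
  then show ?case
    using char_span.add[OF assms(2)[OF add(1)] add(3), of c]
    by (simp add: character_add_left algebra_simps)
qed (simp add: char_span.zero)

lemma char_span_explicit:
  assumes "f \<in> char_span \<Lambda>"
  shows "\<exists>F c. finite F \<and> F \<subseteq> \<Lambda> \<and> (\<forall>x. f x = (\<Sum>\<xi>\<in>F. c \<xi> * character \<xi> x))"
  using assms
proof (induction rule: char_span.induct)
  case zero
  show ?case by (rule exI[of _ "{}"]) simp
next
  case (add \<xi> g a)
  then obtain F c where F: "finite F" "F \<subseteq> \<Lambda>" "\<And>x. g x = (\<Sum>\<xi>\<in>F. c \<xi> * character \<xi> x)"
    by blast
  define c' where "c' \<eta> = (if \<eta> \<in> F then c \<eta> else 0) + (if \<eta> = \<xi> then a else 0)" for \<eta>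
  have "a * character \<xi> x + g x = (\<Sum>\<eta>\<in>insert \<xi> F. c' \<eta> * character \<eta> x)" for x
  proof -
    have "(\<Sum>\<eta>\<in>insert \<xi> F. c' \<eta> * character \<eta> x) =
      (\<Sum>\<eta>\<in>insert \<xi> F. (if \<eta> \<in> F then c \<eta> * character \<eta> x else 0) +
                        (if \<eta> = \<xi> then a * character \<eta> x else 0))"
      by (intro sum.cong) (auto simp: c'_def distrib_right)
    also have "\<dots> = (\<Sum>\<eta>\<in>insert \<xi> F. if \<eta> \<in> F then c \<eta> * character \<eta> x else 0) + a * character \<xi> x"
      using F(1) by (simp add: sum.distrib)
    also have "(\<Sum>\<eta>\<in>insert \<xi> F. if \<eta> \<in> F then c \<eta> * character \<eta> x else 0) = g x"
      unfolding F(3) using F(1) by (intro sum.mono_neutral_cong_right) auto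
    finally show ?thesis by simp
  qed
  then show ?case
    using F(1,2) add(1) by (intro exI[of _ "insert \<xi> F"] exI[of _ c']) auto
qed

lemma char_span_continuous: "f \<in> char_span \<Lambda> \<Longrightarrow> continuous_on UNIV f"
  by (induction rule: char_span.induct)
     (auto intro!: continuous_intros continuous_character)

lemma char_span_bounded: "f \<in> char_span \<Lambda> \<Longrightarrow> \<exists>B. \<forall>x. cmod (f x) \<le> B"
proof (induction rule: char_span.induct)
  case (add \<xi> g c)
  then obtain B where "\<And>x. cmod (g x) \<le> B" by blast
  then have "cmod (c * character \<xi> x + g x) \<le> cmod c + B" for x
    by (intro norm_triangle_le add_mono) (simp_all add: norm_mult)
  then show ?case by blast
qed auto

lemma char_span_measurable: "f \<in> char_span \<Lambda> \<Longrightarrow> f \<in> borel_measurable (lebesgue_on S)"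
  using borel_measurable_continuous_onI[OF char_span_continuous]
  by (metis measurable_restrict_space1 measurable_completion measurable_lborel2)

lemma finite_measure_lebesgue_on: "S \<in> lmeasurable \<Longrightarrow> finite_measure (lebesgue_on S)"
  by (intro finite_measureI) (auto simp: space_restrict_space emeasure_restrict_space fmeasurable_def)

lemma char_span_L2:
  assumes "S \<in> lmeasurable"
  shows "char_span \<Lambda> \<subseteq> L2_space (lebesgue_on S)"
proof
  fix f assume f: "f \<in> char_span \<Lambda>"
  interpret finite_measure "lebesgue_on S" by (rule finite_measure_lebesgue_on[OF assms])
  show "f \<in> L2_space (lebesgue_on S)"
    using char_span_bounded[OF f] char_span_measurable[OF f] L2_space_bounded by blast
qed

lemma trig_poly_mult:
  assumes "f \<in> char_span (range int_vec)" "g \<in> char_span (range int_vec)"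
  shows "(\<lambda>x. f x * g x) \<in> char_span (range int_vec)"
  using assms(2)
proof (induction rule: char_span.induct)
  case (add \<xi> g c)
  then have "(\<lambda>x. f x * character \<xi> x) \<in> char_span (range int_vec)"
    by (intro char_span_shift[OF assms(1)]) (auto simp: int_vec_add[symmetric])
  then have "(\<lambda>x. c * (f x * character \<xi> x) + f x * g x) \<in> char_span (range int_vec)"
    by (intro char_span_add char_span_scale add(3))
  then show ?case by (simp add: algebra_simps)
qed (simp add: char_span.zero)

lemma trig_poly_periodic:
  assumes "f \<in> char_span (range int_vec)"
  shows "f (int_vec a + x) = f x"
  using assms by (induction rule: char_span.induct) (auto simp: character_add_right character_int_vec)

text \<open>The quotient map from the space to the torus, with the torus embedded in \<open>complex ^ 'n\<close>. Periodic
functions are handled as functions on this compact subset.\<close>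

definition torus_map :: "real ^ 'n::finite \<Rightarrow> complex ^ 'n" where
  "torus_map x = (\<chi> i. cis (2 * pi * x $ i))"

lemma continuous_torus_map: "continuous_on S torus_map"
  unfolding torus_map_def by (intro continuous_intros)

lemma trig_poly_coordinates:
  fixes i :: "'n::finite"
  shows "\<exists>t\<in>char_span (range int_vec). \<forall>x. complex_of_real (Re (torus_map x $ i)) = t x"
    and "\<exists>t\<in>char_span (range int_vec). \<forall>x. complex_of_real (Im (torus_map x $ i)) = t x"
proof -
  have ax: "axis i (1 :: real) = int_vec (axis i 1)" "- int_vec (axis i 1) = int_vec (- axis i 1)"
    by (auto simp: vec_eq_iff axis_def)
  have ch: "torus_map x $ i = character (axis i 1) x" 
    "cnj (character (axis i 1) x) = character (- axis i 1) x" for x :: "real ^ 'n"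
    by (simp_all add: torus_map_def character_def inner_axis' cis_cnj)
  have mem: "(\<lambda>x. c * character (axis i 1) x + d * character (- axis i 1) x) \<in> char_span (range int_vec)" for c d
    unfolding ax by (intro char_span_add char_span_character rangeI)
  have "complex_of_real (Re z) = 1/2 * z + 1/2 * cnj z" for z
    by (simp add: complex_eq_iff)
  then show "\<exists>t\<in>char_span (range int_vec). \<forall>x. complex_of_real (Re (torus_map x $ i)) = t x"
    by (intro bexI[OF _ mem[of "1/2" "1/2"]]) (simp add: ch)
  have "complex_of_real (Im z) = -\<i>/2 * z + \<i>/2 * cnj z" for z
    by (simp add: complex_eq_iff)
  then show "\<exists>t\<in>char_span (range int_vec). \<forall>x. complex_of_real (Im (torus_map x $ i)) = t x"
    by (intro bexI[OF _ mem[of "-\<i>/2" "\<i>/2"]]) (simp add: ch)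
qed

text \<open>The real functions on the torus that pull back to trigonometric polynomials form an algebra, and the
real and imaginary parts of the coordinates separate points. So the Stone-Weierstrass theorem applies.\<close>

lemma trig_poly_uniform_approx:
  fixes G :: "complex ^ 'n::finite \<Rightarrow> real"
  assumes "continuous_on UNIV G" "\<epsilon> > 0"
  shows "\<exists>t\<in>char_span (range int_vec). \<forall>x\<in>unit_cube. cmod (complex_of_real (G (torus_map x)) - t x) < \<epsilon>"
proof -
  define S :: "(complex ^ 'n) set" where "S = torus_map ` unit_cube"
  define R where "R = {h :: complex ^ 'n \<Rightarrow> real. continuous_on S h \<and>
    (\<exists>t\<in>char_span (range int_vec). \<forall>x. complex_of_real (h (torus_map x)) = t x)}"
  interpret function_ring_on R S
  proof
    show "compact S"
      unfolding S_def by (intro compact_continuous_image continuous_torus_map) (simp add: unit_cube_def)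
    show "continuous_on S f" if "f \<in> R" for f
      using that by (simp add: R_def)
    fix f g assume fg: "f \<in> R" "g \<in> R"
    then obtain t u where tu: "t \<in> char_span (range int_vec)" "u \<in> char_span (range int_vec)"
      "\<And>x. complex_of_real (f (torus_map x)) = t x" "\<And>x. complex_of_real (g (torus_map x)) = u x"
      unfolding R_def by blast
    show "(\<lambda>x. f x + g x) \<in> R"
      using fg tu by (auto simp: R_def intro!: continuous_intros bexI[OF _ char_span_add[OF tu(1,2)]])
    show "(\<lambda>x. f x * g x) \<in> R"
      using fg tu by (auto simp: R_def intro!: continuous_intros bexI[OF _ trig_poly_mult[OF tu(1,2)]])
  next
    fix c :: real
    have "0 \<in> range (int_vec :: int ^ 'n \<Rightarrow> _)" by (metis int_vec_0 rangeI)
    from char_span_character[OF this, of "of_real c"]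
    show "(\<lambda>_. c) \<in> R" by (auto simp: R_def)
  next
    fix x y assume "x \<in> S" "y \<in> S" "x \<noteq> y"
    then obtain i where "x $ i \<noteq> y $ i" by (auto simp: vec_eq_iff)
    then have "Re (x $ i) \<noteq> Re (y $ i) \<or> Im (x $ i) \<noteq> Im (y $ i)"
      by (auto simp: complex_eq_iff)
    moreover have "continuous_on S (\<lambda>x. Re (x $ i))" "continuous_on S (\<lambda>x. Im (x $ i))"
      by (intro continuous_intros)+
    then have "(\<lambda>x. Re (x $ i)) \<in> R" "(\<lambda>x. Im (x $ i)) \<in> R"
      using trig_poly_coordinates[of i] unfolding R_def by blast+
    ultimately show "\<exists>f\<in>R. f x \<noteq> f y"
      by (elim disjE) (rule bexI, assumption, assumption)+
  qed
  have "continuous_on S G" using assms(1) by (rule continuous_on_subset) auto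
  from Stone_Weierstrass_basic[OF this \<open>\<epsilon> > 0\<close>] obtain g where g: "g \<in> R" "\<And>x. x \<in> S \<Longrightarrow> \<bar>G x - g x\<bar> < \<epsilon>"
    by blast
  then obtain t where t: "t \<in> char_span (range int_vec)" "\<And>x. complex_of_real (g (torus_map x)) = t x"
    unfolding R_def by blast
  have "cmod (complex_of_real (G (torus_map x)) - t x) < \<epsilon>" if "x \<in> unit_cube" for x
    using g(2)[of "torus_map x"] that
    by (simp add: S_def t(2)[symmetric] del: of_real_diff flip: of_real_diff)
  with t(1) show ?thesis by blast
qed


text \<open>Only boundary points of the unit cube are identified on the torus, so that a compact subset of the open
cube can be recovered, within the closed cube, from its image.\<close>

lemma torus_map_inj_open_cube:
  assumes x: "x \<in> unit_cube" and y: "y \<in> box 0 1" and eq: "torus_map x = torus_map y"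
  shows "x = y"
proof -
  have "x $ i = y $ i" for i
  proof -
    have bounds: "0 \<le> x $ i" "x $ i \<le> 1" "0 < y $ i" "y $ i < 1"
      using x y by (auto simp: unit_cube_def mem_box_cart)
    have "cis (2 * pi * x $ i) = cis (2 * pi * y $ i)"
      using eq by (simp add: torus_map_def vec_eq_iff)
    then have "cis (2 * pi * x $ i - 2 * pi * y $ i) = 1"
      by (simp add: cis_divide[symmetric])
    then have "cos (2 * pi * (x $ i - y $ i)) = 1"
      by (simp add: complex_eq_iff right_diff_distrib)
    then obtain k :: int where "2 * pi * (x $ i - y $ i) = of_int k * 2 * pi"
      by (auto simp: cos_one_2pi_int)
    then have k: "x $ i - y $ i = of_int k" by simp
    then have "real_of_int k < 1" "real_of_int k > -1" using bounds by linarith+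
    then have "k = 0" by linarith
    with k show ?thesis by simp
  qed
  then show ?thesis by (simp add: vec_eq_iff)
qed

lemma unit_cube_lmeasurable [simp]: "unit_cube \<in> lmeasurable"
  by (simp add: unit_cube_def)

lemma measure_unit_cube: "measure lebesgue (unit_cube :: (real ^ 'n::finite) set) = 1"
proof -
  have "0 \<in> cbox (0 :: real ^ 'n) 1" by (simp add: mem_box_cart)
  then have "cbox (0 :: real ^ 'n) 1 \<noteq> {}" by blast
  from content_cbox_cart[OF this] show ?thesis
    by (simp add: unit_cube_def)
qed

section \<open>Density of trigonometric polynomials on the unit cube\<close>

abbreviation cube_measure :: "(real ^ 'n::finite) measure" where
  "cube_measure \<equiv> lebesgue_on unit_cube"

text \<open>The indicator of \<open>K\<close> is the pointwise limit of the functions \<open>max 0 (1 - m * d)\<close>, where \<open>d\<close> is the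
distance on the torus to the image of \<open>K\<close>. These are continuous on the torus, hence uniform limits of
trigonometric polynomials; dominated convergence does the rest.\<close>

lemma indicator_compact_in_closure:
  fixes K :: "(real ^ 'n::finite) set"
  assumes K: "compact K" "K \<subseteq> box 0 1"
  shows "indicator K \<in> L2_closure cube_measure (char_span (range int_vec))"
proof (cases "K = {}")
  case True
  then show ?thesis
    by (auto simp: L2_closure_def L2_space_def L2_dist_sq_def intro!: bexI[OF _ char_span.zero])
next
  case False
  interpret Q: finite_measure cube_measure by (simp add: finite_measure_lebesgue_on)
  define G where "G m z = max 0 (1 - real m * infdist z (torus_map ` K))" for m z
  define g where "g m x = complex_of_real (G m (torus_map x))" for m x
  have G01: "0 \<le> G m z" "G m z \<le> 1" for m z
    by (auto simp: G_def infdist_nonneg)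
  have contG: "continuous_on UNIV (G m)" for m
    unfolding G_def by (intro continuous_intros)
  have contg: "continuous_on UNIV (g m)" for m
    unfolding g_def
    by (intro continuous_intros continuous_on_compose2[OF contG continuous_torus_map]) auto
  have g_meas [measurable]: "g m \<in> borel_measurable cube_measure" for m
    using borel_measurable_continuous_onI[OF contg]
    by (metis measurable_restrict_space1 measurable_completion measurable_lborel2)
  have K_meas [measurable]: "K \<in> sets lebesgue" using K(1) by (simp add: compact_imp_closed)
  have ind_meas [measurable]: "(indicator K :: _ \<Rightarrow> complex) \<in> borel_measurable cube_measure"
    by (intro measurable_restrict_space1 borel_measurable_indicator K_meas)
  have gL2: "g m \<in> L2_space cube_measure" for m
    using G01 by (intro Q.L2_space_bounded[of _ 1] g_meas) (simp add: g_def)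
  have indL2: "indicator K \<in> L2_space cube_measure"
    by (intro Q.L2_space_bounded[of _ 1] ind_meas) (simp add: indicator_def)
  have g_closure: "g m \<in> L2_closure cube_measure (char_span (range int_vec))" for m
    unfolding L2_closure_def
  proof (intro CollectI conjI gL2 allI impI)
    fix \<epsilon> :: real assume "\<epsilon> > 0"
    then have "sqrt (\<epsilon> / 2) > 0" by simp
    from trig_poly_uniform_approx[OF contG this] obtain t where
      t: "t \<in> char_span (range int_vec)" "\<And>x. x \<in> unit_cube \<Longrightarrow> cmod (g m x - t x) < sqrt (\<epsilon> / 2)"
      unfolding g_def by blast
    have "L2_dist_sq cube_measure (g m) t \<le> (LINT x|(cube_measure :: (real ^ 'n) measure). \<epsilon> / 2)"
      unfolding L2_dist_sq_def
    proof (rule integral_mono)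
      show "integrable cube_measure (\<lambda>x. (cmod (g m x - t x))\<^sup>2)"
        using L2_space_diff[OF gL2 subsetD[OF char_span_L2[OF unit_cube_lmeasurable] t(1)], of m]
        by (simp add: L2_space_def)
      fix x :: "real ^ 'n" assume "x \<in> space cube_measure"
      then have "(cmod (g m x - t x))\<^sup>2 \<le> (sqrt (\<epsilon> / 2))\<^sup>2"
        using t(2)[of x] by (intro power_mono) (auto simp: space_restrict_space)
      then show "(cmod (g m x - t x))\<^sup>2 \<le> \<epsilon> / 2" using \<open>\<epsilon> > 0\<close> by simp
    qed simp
    also have "\<dots> < \<epsilon>"
      using \<open>\<epsilon> > 0\<close> by (simp add: measure_restrict_space space_restrict_space measure_unit_cube)
    finally show "\<exists>v\<in>char_span (range int_vec). L2_dist_sq cube_measure (g m) v < \<epsilon>"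
      using t(1) by blast
  qed
  \<comment> \<open>Off \<open>K\<close> the distance is positive, which uses that \<open>K\<close> avoids the faces identified on the torus.\<close>
  have lim: "(\<lambda>m. (cmod (indicator K x - g m x))\<^sup>2) \<longlonglongrightarrow> 0" if x: "x \<in> unit_cube" for x
  proof (cases "x \<in> K")
    case True
    then have "infdist (torus_map x) (torus_map ` K) = 0" by simp
    then have "g m x = 1" for m by (simp add: g_def G_def)
    then show ?thesis using True by simp
  next
    case False
    have "torus_map x \<notin> torus_map ` K"
      using torus_map_inj_open_cube[OF x] K(2) False by blast
    moreover have "closed (torus_map ` K)"
      using K(1) by (intro compact_imp_closed compact_continuous_image continuous_torus_map)
    ultimately have "infdist (torus_map x) (torus_map ` K) > 0"
      using \<open>K \<noteq> {}\<close> by (simp add: infdist_pos_not_in_closed)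
    then obtain m0 :: nat where m0: "1 < m0 * infdist (torus_map x) (torus_map ` K)"
      using reals_Archimedean3 by blast
    have "g m x = 0" if "m \<ge> m0" for m
    proof -
      have "m0 * infdist (torus_map x) (torus_map ` K) \<le> m * infdist (torus_map x) (torus_map ` K)"
        using that by (intro mult_right_mono infdist_nonneg) simp
      then show ?thesis using m0 by (simp add: g_def G_def)
    qed
    then have "eventually (\<lambda>m. (cmod (indicator K x - g m x))\<^sup>2 = 0) sequentially"
      using False by (auto simp: eventually_sequentially)
    then show ?thesis by (rule tendsto_eventually)
  qed
  have "(\<lambda>m. L2_dist_sq cube_measure (indicator K) (g m)) \<longlonglongrightarrow> (LINT x|(cube_measure :: (real ^ 'n) measure). (0::real))"
    unfolding L2_dist_sq_def
  proof (rule integral_dominated_convergence[where w="\<lambda>_. 1"])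
    show "AE x in cube_measure. (\<lambda>m. (cmod (indicator K x - g m x))\<^sup>2) \<longlonglongrightarrow> 0"
      using lim by (auto simp: space_restrict_space)
    have "cmod (indicator K x - g m x) \<le> 1" for m x
    proof -
      have "indicator K x - g m x = complex_of_real (indicator K x - G m (torus_map x))"
        by (simp add: g_def indicator_def)
      then have "cmod (indicator K x - g m x) = \<bar>indicator K x - G m (torus_map x)\<bar>"
        by (simp only: norm_of_real)
      then show ?thesis
        using G01[of m "torus_map x"] by (simp add: indicator_def)
    qed
    then show "AE x in cube_measure. norm ((cmod (indicator K x - g m x))\<^sup>2) \<le> 1" for m
      by (auto simp: power_le_one)
  qed auto
  then have lim': "(\<lambda>m. L2_dist_sq cube_measure (indicator K) (g m)) \<longlonglongrightarrow> 0" by simp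
  show ?thesis
  proof (rule L2_closure_closed[OF char_span_L2 indL2])
    fix \<epsilon> :: real assume "\<epsilon> > 0"
    from order_tendstoD(2)[OF lim' this] obtain m where "L2_dist_sq cube_measure (indicator K) (g m) < \<epsilon>"
      by (auto simp: eventually_sequentially)
    then show "\<exists>g\<in>L2_closure cube_measure (char_span (range int_vec)).
        L2_dist_sq cube_measure (indicator K) g < \<epsilon>"
      using g_closure by blast
  qed simp
qed

text \<open>Inner regularity reduces a measurable set to a compact subset of its part in the open cube; the boundary
of the cube is a null set.\<close>

lemma indicator_in_closure:
  fixes A :: "(real ^ 'n::finite) set"
  assumes A: "A \<in> sets lebesgue" "A \<subseteq> unit_cube"
  shows "indicator A \<in> L2_closure cube_measure (char_span (range int_vec))"
proof (rule L2_closure_closed[OF char_span_L2])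
  interpret Q: finite_measure cube_measure by (simp add: finite_measure_lebesgue_on)
  show "indicator A \<in> L2_space cube_measure"
    using A by (intro Q.L2_space_bounded[of _ 1] measurable_restrict_space1 borel_measurable_indicator)
       (simp_all add: indicator_def)
  fix \<epsilon> :: real assume "\<epsilon> > 0"
  have "A \<inter> box 0 1 \<in> sets lebesgue" using A(1) by (intro sets.Int) auto
  from sets_lebesgue_inner_closed[OF this \<open>\<epsilon> > 0\<close>] obtain K where
    K: "closed K" "K \<subseteq> A \<inter> box 0 1" "A \<inter> box 0 1 - K \<in> lmeasurable"
    "emeasure lebesgue (A \<inter> box 0 1 - K) < ennreal \<epsilon>" by blast
  have "bounded K" using K(2) bounded_box by (meson bounded_subset le_inf_iff)
  then have comp: "compact K" using K(1) by (simp add: compact_eq_bounded_closed)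
  have sub: "unit_cube - box 0 (1 :: real ^ 'n) \<in> null_sets lebesgue"
    using negligible_iff_null_sets negligible_frontier_interval unfolding unit_cube_def by blast
  have "L2_dist_sq cube_measure (indicator A) (indicator K) = (LINT x|cube_measure. indicator (A - K) x)"
    unfolding L2_dist_sq_def using K(2)
    by (intro Bochner_Integration.integral_cong) (auto simp: indicator_def)
  also have "\<dots> = (LINT x|lebesgue. indicator unit_cube x *\<^sub>R indicator (A - K) x)"
    by (intro integral_restrict_space) simp
  also have "\<dots> = (LINT x|lebesgue. indicator (A \<inter> box 0 1 - K) x)"
  proof (rule integral_cong_AE)
    show "AE x in lebesgue. indicator unit_cube x *\<^sub>R indicator (A - K) x = (indicator (A \<inter> box 0 1 - K) x :: real)"
      using AE_not_in[OF sub] by eventually_elim (use A(2) in \<open>auto simp: indicator_def\<close>)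
    have "A - K \<in> sets lebesgue" using A comp by (auto simp: compact_imp_closed)
    then show "(\<lambda>x. indicator unit_cube x *\<^sub>R indicator (A - K) x :: real) \<in> borel_measurable lebesgue"
      by (intro borel_measurable_scaleR borel_measurable_indicator) simp_all
    show "(indicator (A \<inter> box 0 1 - K) :: _ \<Rightarrow> real) \<in> borel_measurable lebesgue"
      using K(3) by (intro borel_measurable_indicator) auto
  qed
  also have "\<dots> = measure lebesgue (A \<inter> box 0 1 - K)" by simp
  also have "\<dots> < \<epsilon>"
    using K(3,4) \<open>\<epsilon> > 0\<close> by (simp add: emeasure_eq_measure2 ennreal_less_iff)
  finally show "\<exists>g\<in>L2_closure cube_measure (char_span (range int_vec)).
        L2_dist_sq cube_measure (indicator A) g < \<epsilon>"
    using indicator_compact_in_closure[OF comp] K(2) by blast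
qed simp

text \<open>A square-integrable function is an \<open>L\<^sup>2\<close> limit of simple functions dominated by it up to a constant factor,
and simple functions are linear combinations of indicators.\<close>

theorem trig_poly_dense_L2_cube:
  "(L2_space cube_measure :: (real ^ 'n::finite \<Rightarrow> complex) set) =
   L2_closure cube_measure (char_span (range int_vec))" (is "?L = ?R")
proof
  show "?R \<subseteq> ?L"
    by (auto simp: L2_closure_def)
  show "?L \<subseteq> ?R"
  proof
    fix f :: "real ^ 'n \<Rightarrow> complex" assume f: "f \<in> L2_space cube_measure"
    then have [measurable]: "f \<in> borel_measurable cube_measure" and
      int: "integrable cube_measure (\<lambda>x. (cmod (f x))\<^sup>2)" by (auto simp: L2_space_def)
    let ?V = "char_span (range int_vec) :: (real ^ 'n \<Rightarrow> complex) set"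
    have V: "?V \<subseteq> L2_space cube_measure" by (rule char_span_L2) simp
    have "\<exists>F. (\<forall>i. simple_function cube_measure (F i)) \<and> (\<forall>x\<in>unit_cube. (\<lambda>i. F i x) \<longlonglongrightarrow> f x) \<and>
        (\<forall>i. \<forall>x\<in>unit_cube. cmod (F i x) \<le> 2 * cmod (f x))"
      using borel_measurable_implies_sequence_metric[of f cube_measure 0]
      by (simp add: space_restrict_space)
    then obtain F where
      F: "\<And>i. simple_function cube_measure (F i)" "\<And>x. x \<in> unit_cube \<Longrightarrow> (\<lambda>i. F i x) \<longlonglongrightarrow> f x"
         "\<And>i x. x \<in> unit_cube \<Longrightarrow> cmod (F i x) \<le> 2 * cmod (f x)"
      by blast
    have FV: "F i \<in> L2_closure cube_measure ?V" for i
    proof (rule L2_closure_cong)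
      show "(\<lambda>x. \<Sum>y\<in>F i ` unit_cube. y * indicator (F i -` {y} \<inter> unit_cube) x) \<in> L2_closure cube_measure ?V"
      proof (intro L2_closure_sum L2_closure_scale V indicator_in_closure)
        fix y assume "y \<in> F i ` unit_cube"
        have "F i -` {y} \<inter> space cube_measure \<in> sets cube_measure"
          using simple_functionD(2)[OF F(1)] .
        then show "F i -` {y} \<inter> unit_cube \<in> sets lebesgue"
          by (auto simp: space_restrict_space sets_restrict_space_iff)
      qed (auto intro: char_span_add char_span_scale char_span.zero)
      fix x :: "real ^ 'n" assume "x \<in> space cube_measure"
      then have x: "x \<in> unit_cube" by (simp add: space_restrict_space)
      have fin: "finite (F i ` unit_cube)"
        using simple_functionD(1)[OF F(1)[of i]] by (simp add: space_restrict_space)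
      have "(\<Sum>y\<in>F i ` unit_cube. y * indicator (F i -` {y} \<inter> unit_cube) x) =
            (\<Sum>y\<in>F i ` unit_cube. if y = F i x then y else 0)"
        using x by (intro sum.cong) (auto simp: indicator_def)
      also have "\<dots> = F i x" using x fin by simp
      finally show "(\<Sum>y\<in>F i ` unit_cube. y * indicator (F i -` {y} \<inter> unit_cube) x) = F i x" .
    qed
    have [measurable]: "F i \<in> borel_measurable cube_measure" for i
      using F(1) by (rule borel_measurable_simple_function)
    have "(\<lambda>i. L2_dist_sq cube_measure f (F i)) \<longlonglongrightarrow> (LINT x|(cube_measure :: (real ^ 'n) measure). (0::real))"
      unfolding L2_dist_sq_def
    \<comment> \<open>The simple functions satisfy \<open>cmod (F i x) \<le> 2 * cmod (f x)\<close>, so the difference is at most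
      \<open>3 * cmod (f x)\<close>.\<close>
    proof (rule integral_dominated_convergence[where w="\<lambda>x. 9 * (cmod (f x))\<^sup>2"])
      show "integrable cube_measure (\<lambda>x. 9 * (cmod (f x))\<^sup>2)" using int by simp
      have "(\<lambda>i. (cmod (f x - F i x))\<^sup>2) \<longlonglongrightarrow> (cmod (f x - f x))\<^sup>2" if "x \<in> unit_cube" for x
        by (intro tendsto_intros F(2) that)
      then show "AE x in cube_measure. (\<lambda>i. (cmod (f x - F i x))\<^sup>2) \<longlonglongrightarrow> 0"
        by (auto simp: space_restrict_space)
      have "(cmod (f x - F i x))\<^sup>2 \<le> 9 * (cmod (f x))\<^sup>2" if "x \<in> unit_cube" for i x
      proof -
        have "cmod (f x - F i x) \<le> cmod (f x) + cmod (F i x)" by (rule norm_triangle_ineq4)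
        also have "\<dots> \<le> 3 * cmod (f x)" using F(3)[OF that, of i] by simp
        finally have "(cmod (f x - F i x))\<^sup>2 \<le> (3 * cmod (f x))\<^sup>2" by (intro power_mono) auto
        then show ?thesis by (simp add: power_mult_distrib)
      qed
      then show "AE x in cube_measure. norm ((cmod (f x - F i x))\<^sup>2) \<le> 9 * (cmod (f x))\<^sup>2" for i
        by (auto simp: space_restrict_space)
    qed auto
    then have lim: "(\<lambda>i. L2_dist_sq cube_measure f (F i)) \<longlonglongrightarrow> 0" by simp
    show "f \<in> L2_closure cube_measure ?V"
    proof (rule L2_closure_closed[OF V f])
      fix \<epsilon> :: real assume "\<epsilon> > 0"
      from order_tendstoD(2)[OF lim this] obtain i where "L2_dist_sq cube_measure f (F i) < \<epsilon>"
        by (auto simp: eventually_sequentially)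
      then show "\<exists>g\<in>L2_closure cube_measure ?V. L2_dist_sq cube_measure f g < \<epsilon>"
        using FV by blast
    qed
  qed
qed

section \<open>Unions of lattice cubes\<close>

definition cube_union :: "(int ^ 'n::finite) set \<Rightarrow> (real ^ 'n) set" where
  "cube_union A = (\<Union>a\<in>A. (+) (int_vec a) ` unit_cube)"

lemma mem_translate_unit_cube:
  "x \<in> (+) (int_vec a) ` unit_cube \<longleftrightarrow> (\<forall>i. of_int (a $ i) \<le> x $ i \<and> x $ i \<le> of_int (a $ i) + 1)"
proof -
  have "x \<in> (+) (int_vec a) ` unit_cube \<longleftrightarrow> x - int_vec a \<in> unit_cube"
    by (auto simp: image_iff intro: bexI[of _ "x - int_vec a"])
  also have "\<dots> \<longleftrightarrow> (\<forall>i. of_int (a $ i) \<le> x $ i \<and> x $ i \<le> of_int (a $ i) + 1)"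
    by (auto simp: unit_cube_def mem_box_cart algebra_simps)
  finally show ?thesis .
qed

lemma compact_cube_union: "finite A \<Longrightarrow> compact (cube_union A)"
  unfolding cube_union_def
  by (intro compact_UN compact_translation) (auto simp: unit_cube_def)

lemma translate_unit_cube_lebesgue [simp]: "(+) c ` unit_cube \<in> sets lebesgue"
  by (rule lebesgue_sets_translation) simp

lemma cube_union_lmeasurable: "finite A \<Longrightarrow> cube_union A \<in> lmeasurable"
  using compact_cube_union lmeasurable_compact by blast

lemma negligible_cube_overlap:
  assumes "a \<noteq> b"
  shows "negligible ((+) (int_vec a) ` unit_cube \<inter> (+) (int_vec b) ` unit_cube)"
proof -
  have *: "negligible ((+) (int_vec a) ` unit_cube \<inter> (+) (int_vec b) ` unit_cube)"
    if "a $ i < b $ i" for a b :: "int ^ 'n" and i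
  proof (rule negligible_subset)
    show "negligible {x :: real ^ 'n. x $ i = of_int (b $ i)}"
      using negligible_standard_hyperplane[of "axis i 1 :: real ^ 'n" "of_int (b $ i)"] by (simp add: cart_eq_inner_axis)
    have "real_of_int (a $ i) + 1 \<le> of_int (b $ i)" using that by linarith
    then show "(+) (int_vec a) ` unit_cube \<inter> (+) (int_vec b) ` unit_cube \<subseteq> {x. x $ i = of_int (b $ i)}"
      unfolding mem_translate_unit_cube Int_def by (auto intro: antisym order_trans)
  qed
  obtain i where "a $ i \<noteq> b $ i" using assms by (auto simp: vec_eq_iff)
  then consider "a $ i < b $ i" | "b $ i < a $ i" by linarith
  then show ?thesis using *[of a i b] *[of b i a] by cases (auto simp: Int_commute)
qed

lemma lebesgue_translation_measurable: "(+) c \<in> lebesgue \<rightarrow>\<^sub>M lebesgue"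
  and lebesgue_translation_distr: "distr lebesgue lebesgue ((+) (c :: 'a :: euclidean_space)) = lebesgue"
proof -
  have eq: "(\<lambda>x :: 'a. c + (\<Sum>j\<in>Basis. (1 * (x \<bullet> j)) *\<^sub>R j)) = (+) c"
    by (simp add: euclidean_representation fun_eq_iff)
  show "(+) c \<in> lebesgue \<rightarrow>\<^sub>M lebesgue"
    using lebesgue_affine_measurable[of "\<lambda>_. 1" c] unfolding eq by simp
  show "distr lebesgue lebesgue ((+) c) = lebesgue"
    using lebesgue_affine_euclidean[of "\<lambda>_. 1" c] unfolding eq by (simp add: density_1)
qed

lemma has_bochner_integral_translation:
  fixes h :: "'a :: euclidean_space \<Rightarrow> 'b :: {banach, second_countable_topology}"
  assumes "has_bochner_integral lebesgue (\<lambda>x. h (c + x)) s"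
  shows "has_bochner_integral lebesgue h s"
proof -
  have "(\<lambda>x. h (c + x)) \<in> borel_measurable lebesgue"
    using assms by (auto simp: has_bochner_integral_iff)
  from measurable_compose[OF lebesgue_translation_measurable[of "-c"] this]
  have "h \<in> borel_measurable lebesgue" by simp
  from has_bochner_integral_distr[OF this lebesgue_translation_measurable assms]
  show ?thesis by (simp add: lebesgue_translation_distr)
qed

text \<open>The cubes overlap in null sets only, so an integral over their union is the sum of the integrals over the
cubes, each of which is translated back to the unit cube.\<close>

lemma has_integral_cube_union:
  fixes h :: "real ^ 'n::finite \<Rightarrow> 'b :: {banach, second_countable_topology}"
  assumes A: "finite A" and h: "h \<in> borel_measurable (lebesgue_on (cube_union A))"
    and s: "\<And>a. a \<in> A \<Longrightarrow> has_bochner_integral cube_measure (\<lambda>x. h (int_vec a + x)) (s a)"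
  shows "has_bochner_integral (lebesgue_on (cube_union A)) h (\<Sum>a\<in>A. s a)"
proof -
  let ?C = "\<lambda>a. (+) (int_vec a) ` unit_cube :: (real ^ 'n) set"
  have meas: "cube_union A \<in> sets lebesgue" using cube_union_lmeasurable[OF A] by auto
  have piece: "has_bochner_integral lebesgue (\<lambda>x. indicator (?C a) x *\<^sub>R h x) (s a)" if "a \<in> A" for a
  proof (rule has_bochner_integral_translation[of _ "int_vec a"])
    have ind: "indicator (?C a) (int_vec a + x) = (indicator unit_cube x :: real)" for x
      by (auto simp: indicator_def)
    show "has_bochner_integral lebesgue (\<lambda>x. indicator (?C a) (int_vec a + x) *\<^sub>R h (int_vec a + x)) (s a)"
      using s[OF that] unfolding ind by (subst (asm) has_bochner_integral_restrict_space) auto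
  qed
  have sum: "has_bochner_integral lebesgue (\<lambda>x. \<Sum>a\<in>A. indicator (?C a) x *\<^sub>R h x) (\<Sum>a\<in>A. s a)"
    by (intro has_bochner_integral_sum piece)
  define N where "N = (\<Union>a\<in>A. \<Union>b\<in>A - {a}. ?C a \<inter> ?C b)"
  have inner: "negligible (\<Union>b\<in>A - {a}. ?C a \<inter> ?C b)" for a
    using A by (intro negligible_Union finite_imageI finite_Diff, assumption, elim imageE)
      (auto intro: negligible_cube_overlap[OF not_sym])
  have "negligible N"
    unfolding N_def using A by (intro negligible_Union finite_imageI, assumption, elim imageE) (simp only: inner)
  then have "N \<in> null_sets lebesgue" by (simp add: negligible_iff_null_sets)
  then have ae: "AE x in lebesgue. (\<Sum>a\<in>A. indicator (?C a) x *\<^sub>R h x) = indicator (cube_union A) x *\<^sub>R h x"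
  proof (rule AE_not_in[THEN AE_mp], intro AE_I2 impI)
    fix x assume x: "x \<notin> N"
    show "(\<Sum>a\<in>A. indicator (?C a) x *\<^sub>R h x) = indicator (cube_union A) x *\<^sub>R h x"
    proof (cases "x \<in> cube_union A")
      case True
      then obtain a where a: "a \<in> A" "x \<in> ?C a" by (auto simp: cube_union_def)
      have other: "x \<notin> ?C b" if "b \<in> A" "b \<noteq> a" for b
        using that a x unfolding N_def by blast
      have "indicator (?C b) x *\<^sub>R h x = (if b = a then h x else 0)" if "b \<in> A" for b
      proof (cases "b = a")
        case True
        then show ?thesis by (simp only: indicator_simps(1)[OF a(2)] scaleR_one refl if_True)
      next
        case False
        then show ?thesis by (simp only: indicator_simps(2)[OF other[OF that False]] scaleR_zero_left if_False)
      qed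
      then have "(\<Sum>b\<in>A. indicator (?C b) x *\<^sub>R h x) = (\<Sum>b\<in>A. if b = a then h x else 0)"
        by (intro sum.cong refl)
      then show ?thesis using a(1) A True by (simp only: sum.delta indicator_simps(1) scaleR_one if_True)
    next
      case False
      then have "indicator (?C a) x = (0 :: real)" if "a \<in> A" for a
        using that unfolding cube_union_def by (intro indicator_simps(2)) blast
      then have "(\<Sum>a\<in>A. indicator (?C a) x *\<^sub>R h x) = 0"
        by (intro sum.neutral ballI) (simp only: scaleR_zero_left)
      then show ?thesis
        using False by simp
    qed
  qed
  have "(\<lambda>x. indicator (cube_union A) x *\<^sub>R h x) \<in> borel_measurable lebesgue"
    using h meas by (subst (asm) borel_measurable_restrict_space_iff) auto
  moreover have "(\<lambda>x. \<Sum>a\<in>A. indicator (?C a) x *\<^sub>R h x) \<in> borel_measurable lebesgue"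
    using sum by (auto simp: has_bochner_integral_iff)
  ultimately have "has_bochner_integral lebesgue (\<lambda>x. indicator (cube_union A) x *\<^sub>R h x) (\<Sum>a\<in>A. s a)"
    using sum ae has_bochner_integral_cong_AE by blast
  then show ?thesis
    using meas by (subst has_bochner_integral_restrict_space) auto
qed

lemma measure_cube_union:
  assumes "finite A"
  shows "measure lebesgue (cube_union A) = card A"
proof -
  have "has_bochner_integral (lebesgue_on (cube_union A)) (\<lambda>_. 1 :: real) (\<Sum>a\<in>A. 1)"
  proof (rule has_integral_cube_union[OF assms])
    show "has_bochner_integral cube_measure (\<lambda>x. 1 :: real) 1"
      by (auto simp: has_bochner_integral_iff measure_restrict_space space_restrict_space
          measure_unit_cube finite_measure.integrable_const finite_measure_lebesgue_on)
  qed simp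
  then show ?thesis
    using cube_union_lmeasurable[OF assms]
    by (auto simp: has_bochner_integral_iff measure_restrict_space space_restrict_space)
qed

lemma L2_space_cube_slice:
  assumes A: "finite A" "a \<in> A" and f: "f \<in> L2_space (lebesgue_on (cube_union A))"
  shows "(\<lambda>x. f (int_vec a + x)) \<in> L2_space cube_measure"
proof -
  let ?C = "(+) (int_vec a) ` unit_cube"
  have sub: "?C \<subseteq> cube_union A" using A by (auto simp: cube_union_def)
  have meas: "cube_union A \<in> sets lebesgue" using cube_union_lmeasurable[OF A(1)] by auto
  have "(+) (int_vec a) \<in> cube_measure \<rightarrow>\<^sub>M lebesgue_on (cube_union A)"
    using sub by (intro measurable_restrict_space3 lebesgue_translation_measurable) auto
  from measurable_compose[OF this, of f borel] f
  have 1: "(\<lambda>x. f (int_vec a + x)) \<in> borel_measurable cube_measure"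
    by (simp add: L2_space_def)
  have "integrable lebesgue (\<lambda>x. indicator (cube_union A) x *\<^sub>R (cmod (f x))\<^sup>2)"
    using f meas by (simp add: L2_space_def integrable_restrict_space)
  then have "set_integrable lebesgue (cube_union A) (\<lambda>x. (cmod (f x))\<^sup>2)"
    by (simp add: set_integrable_def)
  then have "set_integrable lebesgue ?C (\<lambda>x. (cmod (f x))\<^sup>2)"
    by (rule set_integrable_subset) (use sub in auto)
  then have "integrable (distr lebesgue lebesgue ((+) (int_vec a))) (\<lambda>x. indicator ?C x *\<^sub>R (cmod (f x))\<^sup>2)"
    by (simp add: set_integrable_def lebesgue_translation_distr)
  from integrable_distr[OF lebesgue_translation_measurable this]
  have "integrable lebesgue (\<lambda>x. indicator ?C (int_vec a + x) *\<^sub>R (cmod (f (int_vec a + x)))\<^sup>2)" .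
  also have "(\<lambda>x. indicator ?C (int_vec a + x) *\<^sub>R (cmod (f (int_vec a + x)))\<^sup>2) =
             (\<lambda>x. indicator unit_cube x *\<^sub>R (cmod (f (int_vec a + x)))\<^sup>2)"
    by (auto simp: indicator_def fun_eq_iff)
  finally have "integrable cube_measure (\<lambda>x. (cmod (f (int_vec a + x)))\<^sup>2)"
    by (simp add: integrable_restrict_space)
  with 1 show ?thesis by (simp add: L2_space_def)
qed

lemma L2_space_mult_cnj_character:
  assumes "f \<in> L2_space (lebesgue_on S)"
  shows "(\<lambda>x. cnj (character \<xi> x) * f x) \<in> L2_space (lebesgue_on S)"
proof -
  have "continuous_on UNIV (\<lambda>x. cnj (character \<xi> x))"
    by (intro continuous_intros continuous_character)
  from borel_measurable_continuous_onI[OF this]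
  have "(\<lambda>x. cnj (character \<xi> x)) \<in> borel_measurable (lebesgue_on S)"
    by (metis measurable_restrict_space1 measurable_completion measurable_lborel2)
  with assms show ?thesis
    by (auto simp: L2_space_def norm_mult)
qed

section \<open>Spectra of unions of lattice cubes\<close>

lemma exp_eq_character:
  "exp (2 * complex_of_real pi * \<i> * complex_of_real (\<xi> \<bullet> x)) = character \<xi> x"
  by (simp add: character_def cis_conv_exp mult_ac)

text \<open>A finite set of lattice points that is spectral yields a spectral union of cubes. The hypotheses say
that the matrix of the values of the characters \<open>\<beta> j\<close> at the points of \<open>A\<close> has orthogonal rows and
orthogonal columns. For two frequencies that differ by \<open>\<beta> i - \<beta> j\<close> plus an integral vector, the inner
product is a character sum over \<open>A\<close> times an integral over the unit cube: the rows kill the first factor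
if \<open>i \<noteq> j\<close>, and the second factor is Fourier orthogonality on the cube if \<open>i = j\<close>.

For completeness, a function \<open>f\<close> on the union is a family of functions \<open>f (int_vec a + x)\<close> on the unit
cube indexed by \<open>A\<close>. By orthogonality of the columns, \<open>f\<close> is a combination of the characters \<open>\<beta> j\<close> with
coefficients that are functions on the unit cube. Replacing these coefficients by trigonometric
polynomials, whose periodicity makes them agree on all the cubes, gives the approximation.\<close>

theorem is_spectrum_cube_union:
  fixes A :: "(int ^ 'n::finite) set" and \<beta> :: "'j \<Rightarrow> real ^ 'n"
  assumes A: "finite A" "A \<noteq> {}" and J: "finite J" "J \<noteq> {}"
    and rows: "\<And>i j. i \<in> J \<Longrightarrow> j \<in> J \<Longrightarrow> i \<noteq> j \<Longrightarrow> (\<Sum>a\<in>A. character (\<beta> i - \<beta> j) (int_vec a)) = 0"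
    and cols: "\<And>a b. a \<in> A \<Longrightarrow> b \<in> A \<Longrightarrow> a \<noteq> b \<Longrightarrow> (\<Sum>j\<in>J. character (\<beta> j) (int_vec (a - b))) = 0"
  shows "is_spectrum {\<beta> j + int_vec k | j k. j \<in> J} (cube_union A)"
proof -
  define \<Omega> where "\<Omega> = cube_union A"
  define \<Lambda> where "\<Lambda> = {\<beta> j + int_vec k | j k. j \<in> J}"
  define N where "N = real (card A)"
  have N: "N > 0" using A by (simp add: N_def card_gt_0_iff)
  have \<Omega>: "\<Omega> \<in> lmeasurable" "measure lebesgue \<Omega> = N"
    using A by (simp_all add: \<Omega>_def N_def cube_union_lmeasurable measure_cube_union)
  define e where "e \<xi> x = 1 / complex_of_real (sqrt N) * character \<xi> x" for \<xi> x :: "real ^ 'n"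
  have e_span: "e \<xi> \<in> char_span {\<xi>}" for \<xi>
    unfolding e_def [abs_def] by (rule char_span_character) simp
  have e_L2: "e \<xi> \<in> L2_space (lebesgue_on \<Omega>)" for \<xi>
    using e_span char_span_L2[OF \<Omega>(1)] by blast

  have orth: "L2_inner (lebesgue_on \<Omega>) (e \<xi>) (e \<eta>) = (if \<xi> = \<eta> then 1 else 0)"
    if "\<xi> \<in> \<Lambda>" "\<eta> \<in> \<Lambda>" for \<xi> \<eta>
  proof -
    from that obtain i j k l where ij: "i \<in> J" "j \<in> J" "\<xi> = \<beta> i + int_vec k" "\<eta> = \<beta> j + int_vec l"
      by (auto simp: \<Lambda>_def)
    have diff: "\<xi> - \<eta> = (\<beta> i - \<beta> j) + int_vec (k - l)"
      by (simp add: ij int_vec_diff)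
    define I where "I = (LINT x|cube_measure. character (\<xi> - \<eta>) x)"
    have char_L2: "character (\<xi> - \<eta>) \<in> borel_measurable (lebesgue_on S)" for S
      using char_span_measurable[OF char_span_character[of "\<xi> - \<eta>" "{\<xi> - \<eta>}" 1]] by simp
    have "integrable cube_measure (character (\<xi> - \<eta>))"
      by (rule finite_measure.integrable_const_bound[where B=1])
         (auto simp: finite_measure_lebesgue_on char_L2)
    then have bi: "has_bochner_integral cube_measure (character (\<xi> - \<eta>)) I"
      by (simp add: I_def has_bochner_integral_iff)
    have "has_bochner_integral (lebesgue_on \<Omega>) (character (\<xi> - \<eta>))
            (\<Sum>a\<in>A. character (\<xi> - \<eta>) (int_vec a) * I)"
      unfolding \<Omega>_def
      by (intro has_integral_cube_union[OF A(1)] char_L2)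
         (simp add: character_add_right has_bochner_integral_mult_right bi)
    moreover have "character (\<xi> - \<eta>) (int_vec a) = character (\<beta> i - \<beta> j) (int_vec a)" for a
      by (simp add: diff character_add_left character_int_vec)
    ultimately have int: "(LINT x|lebesgue_on \<Omega>. character (\<xi> - \<eta>) x) =
            (\<Sum>a\<in>A. character (\<beta> i - \<beta> j) (int_vec a)) * I"
      by (simp add: has_bochner_integral_iff sum_distrib_right)
    have "L2_inner (lebesgue_on \<Omega>) (e \<xi>) (e \<eta>) =
          (LINT x|lebesgue_on \<Omega>. 1 / complex_of_real N * character (\<xi> - \<eta>) x)"
      unfolding L2_inner_def e_def using N
      by (intro Bochner_Integration.integral_cong)
         (simp_all add: character_diff_left field_simps flip: of_real_mult)
    also have "\<dots> = 1 / complex_of_real N * (LINT x|lebesgue_on \<Omega>. character (\<xi> - \<eta>) x)"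
      by (rule integral_mult_right_zero)
    also have "\<dots> = (if \<xi> = \<eta> then 1 else 0)"
    proof (cases "i = j")
      case True
      then have "I = (if k = l then 1 else 0)"
        using character_integral_unit_cube[of "k - l"] by (simp add: I_def diff)
      then show ?thesis
        unfolding int using True ij N by (auto simp: N_def)
    next
      case False
      then have sum0: "(\<Sum>a\<in>A. character (\<beta> i - \<beta> j) (int_vec a)) = 0"
        using rows ij by blast
      have "\<xi> \<noteq> \<eta>"
      proof
        assume "\<xi> = \<eta>"
        then have "\<beta> i - \<beta> j = int_vec (l - k)" using ij by (simp add: int_vec_diff algebra_simps)
        then show False using sum0 A by (simp add: character_int_vec)
      qed
      then show ?thesis unfolding int sum0 by simp
    qed
    finally show ?thesis .
  qed

  have dense: "\<exists>F c. finite F \<and> F \<subseteq> \<Lambda> \<and> L2_norm (lebesgue_on \<Omega>) (\<lambda>x. f x - (\<Sum>\<xi>\<in>F. c \<xi> * e \<xi> x)) < \<epsilon>"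
    if f: "f \<in> L2_space (lebesgue_on \<Omega>)" and \<epsilon>: "\<epsilon> > 0" for f \<epsilon>
  proof -
    define M where "M = real (card J)"
    have M: "M > 0" using J by (simp add: M_def card_gt_0_iff)
    \<comment> \<open>The Fourier coefficient at \<open>\<beta> j\<close> of \<open>f\<close> along the points \<open>int_vec a + x\<close> for \<open>a \<in> A\<close>, written so that
      each summand is visibly square-integrable in \<open>x\<close>.\<close>
    define c where "c j x = (\<Sum>a\<in>A. (cnj (character (\<beta> j) (int_vec a)) / M) *
       (cnj (character (\<beta> j) x) * f (int_vec a + x)))" for j x
    have c_L2: "c j \<in> L2_space cube_measure" for j
      unfolding c_def [abs_def]
      by (intro L2_space_sum L2_space_scale L2_space_mult_cnj_character L2_space_cube_slice)
         (use A f in \<open>auto simp: \<Omega>_def\<close>)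
    have recon: "f (int_vec a + x) = (\<Sum>j\<in>J. c j x * character (\<beta> j) (int_vec a + x))" if "a \<in> A" for a x
    proof -
      have "(\<Sum>j\<in>J. c j x * character (\<beta> j) (int_vec a + x)) =
            (\<Sum>j\<in>J. \<Sum>b\<in>A. f (int_vec b + x) / M * character (\<beta> j) (int_vec (a - b)))"
      proof (intro sum.cong refl)
        fix j
        have *: "(cnj (character (\<beta> j) (int_vec b)) / M) *
           (cnj (character (\<beta> j) x) * f (int_vec b + x)) * character (\<beta> j) (int_vec a + x) =
           f (int_vec b + x) / M * character (\<beta> j) (int_vec (a - b))" for b
        proof -
          have "character (\<beta> j) (int_vec (a - b)) =
            character (\<beta> j) (int_vec a) * cnj (character (\<beta> j) (int_vec b)) *
             (character (\<beta> j) x * cnj (character (\<beta> j) x))"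
            by (simp add: int_vec_diff character_diff_right)
          then show ?thesis by (simp add: character_add_right del: character_mult_cnj)
        qed
        show "c j x * character (\<beta> j) (int_vec a + x) =
          (\<Sum>b\<in>A. f (int_vec b + x) / M * character (\<beta> j) (int_vec (a - b)))"
          unfolding c_def sum_distrib_right * ..
      qed
      also have "\<dots> = (\<Sum>b\<in>A. f (int_vec b + x) / M * (\<Sum>j\<in>J. character (\<beta> j) (int_vec (a - b))))"
        by (subst sum.swap) (simp add: sum_distrib_left)
      also have "\<dots> = (\<Sum>b\<in>A. if b = a then f (int_vec b + x) else 0)"
        using cols[OF that] M by (intro sum.cong) (auto simp: M_def)
      also have "\<dots> = f (int_vec a + x)" using that A by simp
      finally show ?thesis ..
    qed
    \<comment> \<open>One factor \<open>M\<close> comes from the Cauchy-Schwarz inequality for the sum over \<open>J\<close>, the other one from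
      adding up the errors of the \<open>M\<close> coefficients, and \<open>N\<close> from the sum over the cubes.\<close>
    define \<delta> where "\<delta> = \<epsilon>\<^sup>2 / (2 * N * M\<^sup>2)"
    have "\<delta> > 0" using \<epsilon> N M by (simp add: \<delta>_def)
    have "\<exists>t\<in>char_span (range int_vec). L2_dist_sq cube_measure (c j) t < \<delta>" for j
      using c_L2[of j] \<open>\<delta> > 0\<close> unfolding trig_poly_dense_L2_cube by (simp add: L2_closure_def)
    then obtain t where t: "\<And>j. t j \<in> char_span (range int_vec)"
      "\<And>j. L2_dist_sq cube_measure (c j) (t j) < \<delta>" by metis
    define g where "g x = (\<Sum>j\<in>J. t j x * character (\<beta> j) x)" for x
    have g_span: "g \<in> char_span \<Lambda>"
      unfolding g_def [abs_def]
      by (intro char_span_sum char_span_shift[OF t(1)]) (auto simp: \<Lambda>_def add.commute)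
    have g_L2: "g \<in> L2_space (lebesgue_on \<Omega>)"
      using g_span char_span_L2[OF \<Omega>(1)] by blast
    have fg: "(\<lambda>x. f x - g x) \<in> L2_space (lebesgue_on \<Omega>)"
      using f g_L2 by (rule L2_space_diff)
    have slice_bound: "(cmod (f (int_vec a + x) - g (int_vec a + x)))\<^sup>2 \<le> M * (\<Sum>j\<in>J. (cmod (c j x - t j x))\<^sup>2)"
      if "a \<in> A" for a x
    proof -
      have "f (int_vec a + x) - g (int_vec a + x) =
            (\<Sum>j\<in>J. (c j x - t j x) * character (\<beta> j) (int_vec a + x))"
        unfolding recon[OF that] g_def
        by (simp add: trig_poly_periodic[OF t(1)] sum_subtractf left_diff_distrib)
      also have "cmod \<dots> \<le> (\<Sum>j\<in>J. cmod (c j x - t j x))"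
        by (rule order_trans[OF norm_sum]) (simp add: norm_mult)
      finally have "(cmod (f (int_vec a + x) - g (int_vec a + x)))\<^sup>2 \<le> (\<Sum>j\<in>J. cmod (c j x - t j x))\<^sup>2"
        by (intro power_mono) auto
      also have "\<dots> \<le> (\<Sum>j\<in>J. (cmod (c j x - t j x))\<^sup>2) * card J"
        by (rule sum_squared_le_sum_of_squares)
      finally show ?thesis by (simp add: M_def mult.commute)
    qed
    have slice_int: "integrable cube_measure (\<lambda>x. (cmod (f (int_vec a + x) - g (int_vec a + x)))\<^sup>2)"
      if "a \<in> A" for a
      using L2_space_cube_slice[OF A(1) that fg[unfolded \<Omega>_def]] by (simp add: L2_space_def)
    have ct_int: "integrable cube_measure (\<lambda>x. (cmod (c j x - t j x))\<^sup>2)" for j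
      using L2_space_diff[OF c_L2 subsetD[OF char_span_L2[OF unit_cube_lmeasurable] t(1)], of j j]
      by (simp add: L2_space_def)
    have "has_bochner_integral (lebesgue_on \<Omega>) (\<lambda>x. (cmod (f x - g x))\<^sup>2)
           (\<Sum>a\<in>A. (LINT x|cube_measure. (cmod (f (int_vec a + x) - g (int_vec a + x)))\<^sup>2))"
      unfolding \<Omega>_def
    proof (rule has_integral_cube_union[OF A(1)])
      show "(\<lambda>x. (cmod (f x - g x))\<^sup>2) \<in> borel_measurable (lebesgue_on (cube_union A))"
        using fg by (auto simp: L2_space_def \<Omega>_def)
    qed (use slice_int in \<open>auto simp: has_bochner_integral_iff\<close>)
    then have "(LINT x|lebesgue_on \<Omega>. (cmod (f x - g x))\<^sup>2) =
        (\<Sum>a\<in>A. (LINT x|cube_measure. (cmod (f (int_vec a + x) - g (int_vec a + x)))\<^sup>2))"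
      by (simp add: has_bochner_integral_iff)
    also have "\<dots> \<le> (\<Sum>a\<in>A. (LINT x|cube_measure. M * (\<Sum>j\<in>J. (cmod (c j x - t j x))\<^sup>2)))"
      by (intro sum_mono integral_mono slice_int slice_bound integrable_mult_right
          Bochner_Integration.integrable_sum ct_int)
    also have "\<dots> = N * (M * (\<Sum>j\<in>J. L2_dist_sq cube_measure (c j) (t j)))"
      using ct_int by (simp add: L2_dist_sq_def N_def)
    also have "\<dots> \<le> N * (M * (\<Sum>j\<in>J. \<delta>))"
      using N M t(2) by (intro mult_left_mono sum_mono) (auto intro: less_imp_le)
    also have "\<dots> = \<epsilon>\<^sup>2 / 2"
      using N M by (simp add: \<delta>_def M_def[symmetric] power2_eq_square)
    also have "\<dots> < \<epsilon>\<^sup>2" using \<epsilon> by simp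
    finally have "sqrt (LINT x|lebesgue_on \<Omega>. (cmod (f x - g x))\<^sup>2) < sqrt (\<epsilon>\<^sup>2)"
      by (rule real_sqrt_less_mono)
    then have norm: "L2_norm (lebesgue_on \<Omega>) (\<lambda>x. f x - g x) < \<epsilon>"
      using \<epsilon> by (simp add: L2_norm_def)
    from char_span_explicit[OF g_span] obtain F d where
      F: "finite F" "F \<subseteq> \<Lambda>" "\<And>x. g x = (\<Sum>\<xi>\<in>F. d \<xi> * character \<xi> x)" by blast
    have "g x = (\<Sum>\<xi>\<in>F. (d \<xi> * complex_of_real (sqrt N)) * e \<xi> x)" for x
      using N by (simp add: F(3) e_def)
    then show ?thesis
      using F(1,2) norm by (intro exI[of _ F] exI[of _ "\<lambda>\<xi>. d \<xi> * complex_of_real (sqrt N)"]) simp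
  qed

  have "L2_orthonormal_basis (lebesgue_on \<Omega>) \<Lambda> e"
    unfolding L2_orthonormal_basis_def by (intro conjI ballI allI impI e_L2 orth dense)
  then show ?thesis
    unfolding is_spectrum_def exp_eq_character \<Omega>_def[symmetric] \<Lambda>_def[symmetric] \<Omega>(2) e_def [abs_def] .
qed

section \<open>Character sums over lattice boxes\<close>

definition lattice_box :: "nat \<Rightarrow> (int ^ 'n::finite) set" where
  "lattice_box M = {k. \<forall>i. 0 \<le> k $ i \<and> k $ i < int M}"

lemma sum_lattice_box_prod:
  fixes f :: "'n::finite \<Rightarrow> int \<Rightarrow> 'b::comm_semiring_1"
  shows "(\<Sum>k\<in>lattice_box M. \<Prod>i\<in>UNIV. f i (k $ i)) = (\<Prod>i\<in>UNIV. \<Sum>j\<in>{0..<int M}. f i j)"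
proof -
  have "(\<Prod>i\<in>UNIV. \<Sum>j\<in>{0..<int M}. f i j) =
        (\<Sum>g\<in>(\<Pi>\<^sub>E i\<in>UNIV. {0..<int M}). \<Prod>i\<in>UNIV. f i (g i))"
    by (rule prod_sum_PiE) auto
  also have "\<dots> = (\<Sum>k\<in>lattice_box M. \<Prod>i\<in>UNIV. f i (k $ i))"
    by (rule sum.reindex_bij_witness[where i=vec_nth and j=vec_lambda])
       (auto simp: lattice_box_def PiE_iff)
  finally show ?thesis ..
qed

lemma finite_lattice_box: "finite (lattice_box M :: (int ^ 'n::finite) set)"
proof -
  have "lattice_box M \<subseteq> vec_lambda ` (\<Pi>\<^sub>E i\<in>(UNIV :: 'n set). {0..<int M})"
  proof
    fix k :: "int ^ 'n" assume "k \<in> lattice_box M"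
    then show "k \<in> vec_lambda ` (\<Pi>\<^sub>E i\<in>(UNIV :: 'n set). {0..<int M})"
      by (intro image_eqI[of _ _ "vec_nth k"]) (auto simp: lattice_box_def PiE_iff)
  qed
  then show ?thesis by (rule finite_subset) (simp add: finite_PiE)
qed

lemma card_lattice_box: "card (lattice_box M :: (int ^ 'n::finite) set) = M ^ CARD('n)"
  using sum_lattice_box_prod[where f="\<lambda>(_::'n) _. 1::nat"] by simp

text \<open>A geometric sum over the powers of an \<open>M\<close>-th root of unity other than 1.\<close>

lemma cis_sum_eq_0:
  fixes d :: int
  assumes "d \<noteq> 0" "\<bar>d\<bar> < int M"
  shows "(\<Sum>j\<in>{0..<int M}. cis (2 * pi * (d / M * j))) = 0"
proof -
  define z where "z = cis (2 * pi * (d / M))"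
  have M: "M > 0" using assms by linarith
  have z1: "z \<noteq> 1"
  proof
    assume "z = 1"
    then have "cos (2 * pi * (d / M)) = 1" by (simp add: z_def complex_eq_iff)
    then obtain k :: int where "2 * pi * (d / M) = of_int k * 2 * pi"
      by (subst (asm) cos_one_2pi_int) blast
    then have "real_of_int d = of_int k * M" using M by (simp add: field_simps)
    then have "real_of_int d = real_of_int (k * int M)" by simp
    then have "d = k * int M" by (simp only: of_int_eq_iff)
    then show False using assms dvd_imp_le_int[of d "int M"] by simp
  qed
  have zM: "z ^ M = 1"
  proof -
    have "real M * (2 * pi * (d / M)) = 2 * pi * d" using M by simp
    then show ?thesis unfolding z_def Complex.DeMoivre by (simp only: cis_2pi_int)
  qed
  have "(\<Sum>j\<in>{0..<int M}. cis (2 * pi * (d / M * j))) = (\<Sum>j\<in>int ` {0..<M}. cis (2 * pi * (d / M * j)))"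
    by (simp add: image_int_atLeastLessThan)
  also have "\<dots> = (\<Sum>j<M. z ^ j)"
    unfolding lessThan_atLeast0 z_def Complex.DeMoivre
    by (subst sum.reindex) (simp_all add: o_def mult.commute mult.left_commute)
  also have "\<dots> = 0" using z1 zM by (simp add: geometric_sum)
  finally show ?thesis .
qed

lemma character_sum_lattice_box:
  fixes m m' :: "int ^ 'n::finite"
  assumes "m \<in> lattice_box M" "m' \<in> lattice_box M" "m \<noteq> m'"
  shows "(\<Sum>k\<in>lattice_box M. character ((1 / real M) *\<^sub>R int_vec (m - m')) (int_vec k)) = 0"
proof -
  obtain i where i: "m $ i \<noteq> m' $ i" using assms by (auto simp: vec_eq_iff)
  have "\<bar>m $ i - m' $ i\<bar> < int M"
    using assms(1,2) unfolding lattice_box_def by (auto simp: abs_less_iff) (smt (verit) assms)+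
  with i have 0: "(\<Sum>j\<in>{0..<int M}. cis (2 * pi * (of_int (m $ i - m' $ i) / M * j))) = 0"
    by (intro cis_sum_eq_0) auto
  have "(\<Sum>k\<in>lattice_box M. character ((1 / real M) *\<^sub>R int_vec (m - m')) (int_vec k)) =
        (\<Sum>k\<in>lattice_box M. \<Prod>i\<in>UNIV. cis (2 * pi * (of_int (m $ i - m' $ i) / M * of_int (k $ i))))"
    by (simp add: character_prod)
  also have "\<dots> = (\<Prod>i\<in>UNIV. \<Sum>j\<in>{0..<int M}. cis (2 * pi * (of_int (m $ i - m' $ i) / M * j)))"
    by (rule sum_lattice_box_prod)
  also have "\<dots> = 0" using 0 by (intro prod_zero) auto
  finally show ?thesis .
qed

section \<open>A complex Hadamard matrix of order six\<close>

text \<open>Exponents of a matrix of third roots of unity with orthogonal rows, that is, a Butson matrix of type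
\<open>BH(6, 3)\<close>. The matrix is symmetric, so its columns are
orthogonal too, and it is normalised to have a zero first column, which belongs to the origin.\<close>

definition butson6 :: "nat \<Rightarrow> nat \<Rightarrow> int" where
  "butson6 l j =
    [[0, 0, 0, 0, 0, 0],
     [0, 0, 1, 1, 2, 2],
     [0, 1, 0, 2, 2, 1],
     [0, 1, 2, 0, 1, 2],
     [0, 2, 2, 1, 0, 1],
     [0, 2, 1, 2, 1, 0]] ! l ! j"

lemma butson6_sym: "l < 6 \<Longrightarrow> j < 6 \<Longrightarrow> butson6 l j = butson6 j l"
proof -
  have "\<forall>l\<in>set [0..<6]. \<forall>j\<in>set [0..<6]. butson6 l j = butson6 j l"
    by code_simp
  then show "l < 6 \<Longrightarrow> j < 6 \<Longrightarrow> butson6 l j = butson6 j l" by simp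
qed

lemma butson6_0: "l < 6 \<Longrightarrow> butson6 l 0 = 0"
proof -
  have "\<forall>l\<in>set [0..<6]. butson6 l 0 = 0" by code_simp
  then show "l < 6 \<Longrightarrow> butson6 l 0 = 0" by simp
qed

text \<open>Modulo 3, the difference of two distinct rows takes each of the values 0, 1, 2 exactly twice.\<close>

lemma butson6_orthogonal:
  assumes "l < 6" "l' < 6" "l \<noteq> l'"
  shows "(\<Sum>j<6. cis (2 * pi * (of_int (butson6 l j - butson6 l' j) / 3))) = 0"
proof -
  define f where "f r = cis (2 * pi * (of_int r / 3))" for r :: int
  have f_mod: "f (r mod 3) = f r" for r
  proof -
    have "f r = f (r mod 3 + 3 * (r div 3))" by simp
    also have "\<dots> = f (r mod 3) * cis (2 * pi * of_int (r div 3))"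
      unfolding f_def cis_mult of_int_add of_int_mult
      by (intro arg_cong[where f=cis]) (simp add: field_simps)
    finally show ?thesis by (simp add: cis_2pi_int)
  qed
  have "\<forall>l\<in>set [0..<6]. \<forall>l'\<in>set [0..<6]. l \<noteq> l' \<longrightarrow>
      sort (map (\<lambda>j. (butson6 l j - butson6 l' j) mod 3) [0..<6]) = [0, 0, 1, 1, 2, 2]"
    by code_simp
  then have sort: "sort (map (\<lambda>j. (butson6 l j - butson6 l' j) mod 3) [0..<6]) = [0, 0, 1, 1, 2, 2]"
    using assms by simp
  have "(\<Sum>j<6. f (butson6 l j - butson6 l' j)) =
        (\<Sum>j\<in>set [0..<6]. f ((butson6 l j - butson6 l' j) mod 3))"
    unfolding f_mod by (intro sum.cong) auto
  also have "\<dots> = sum_list (map (\<lambda>j. f ((butson6 l j - butson6 l' j) mod 3)) [0..<6])"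
    by (rule interv_sum_list_conv_sum_set_nat[symmetric])
  also have "\<dots> = sum_list (map f (map (\<lambda>j. (butson6 l j - butson6 l' j) mod 3) [0..<6]))"
    by (simp only: map_map o_def)
  also have "\<dots> = sum_mset (image_mset f (mset (map (\<lambda>j. (butson6 l j - butson6 l' j) mod 3) [0..<6])))"
    by (simp only: mset_map[symmetric] sum_mset_sum_list)
  also have "\<dots> = sum_mset (image_mset f (mset [0, 0, 1, 1, 2, 2]))"
    unfolding sort[symmetric] mset_sort ..
  also have "\<dots> = 2 * (\<Sum>j\<in>{0..<int 3}. cis (2 * pi * (of_int 1 / real 3 * j)))"
  proof -
    have "{0..<int 3} = {0, 1, 2}" by auto
    then show ?thesis by (simp add: f_def)
  qed
  also have "\<dots> = 0" by (subst cis_sum_eq_0) auto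
  finally show ?thesis by (simp add: f_def)
qed

section \<open>From tilings of the space to tilings of the lattice\<close>

text \<open>The translation vectors of a tiling of the space are arbitrary real vectors. Restricting the tiling to a
coset \<open>x + int_vec v\<close> of the lattice, for generic \<open>x\<close>, gives a tiling of the lattice by \<open>A\<close>: for almost
all \<open>x\<close> no point of the coset lies on the boundary of a cube or outside all tiles, and a translate of the
open unit cube contains at most one point of the coset.\<close>

lemma lattice_tiling_of_tiling:
  fixes A :: "(int ^ 'n::finite) set"
  assumes A: "finite A" "A \<noteq> {}" and tiles: "tiles_by_translations (cube_union A)"
  shows "\<exists>S. \<forall>y. \<exists>!s. s \<in> S \<and> y - s \<in> A"
proof -
  define \<Omega> where "\<Omega> = cube_union A"
  define W where "W = (\<Union>a\<in>A. (+) (int_vec a) ` box 0 (1 :: real ^ 'n))"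
  have "box 0 (1 :: real ^ 'n) \<subseteq> unit_cube"
    unfolding unit_cube_def by (rule box_subset_cbox)
  then have W\<Omega>: "W \<subseteq> \<Omega>" by (auto simp: W_def \<Omega>_def cube_union_def)
  have openW: "open W" unfolding W_def by (intro open_UN ballI open_translation open_box)
  have "(\<chi> i. 1/2) \<in> box 0 (1 :: real ^ 'n)" by (simp add: mem_box_cart)
  then have "W \<noteq> {}" using A(2) by (auto simp: W_def)
  have negl: "negligible (\<Omega> - W)"
  proof (rule negligible_subset)
    let ?F = "\<lambda>a. (+) (int_vec a) ` (unit_cube - box 0 (1 :: real ^ 'n))"
    have "negligible (?F a)" for a
      unfolding unit_cube_def by (rule negligible_translation[OF negligible_frontier_interval])
    then show "negligible (\<Union>a\<in>A. ?F a)"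
      using A(1) by (intro negligible_Union finite_imageI) blast+
    show "\<Omega> - W \<subseteq> (\<Union>a\<in>A. ?F a)"
      by (force simp: \<Omega>_def W_def cube_union_def)
  qed
  from tiles obtain T0 where
    T0: "pairwise (\<lambda>A B. negligible (A \<inter> B)) ((\<lambda>t. (+) t ` \<Omega>) ` T0)"
        "negligible (- (\<Union>t\<in>T0. (+) t ` \<Omega>))"
    unfolding tiles_by_translations_def \<Omega>_def[symmetric] by blast
  \<comment> \<open>A translation vector is chosen for each tile, so that distinct vectors in \<open>T\<close> give distinct tiles.\<close>
  obtain T where T: "inj_on (\<lambda>t. (+) t ` \<Omega>) T" "(\<lambda>t. (+) t ` \<Omega>) ` T0 = (\<lambda>t. (+) t ` \<Omega>) ` T"
    using subset_image_inj[of "(\<lambda>t. (+) t ` \<Omega>) ` T0" "\<lambda>t. (+) t ` \<Omega>" T0] by auto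
  have disj: "(+) s ` W \<inter> (+) t ` W = {}" if "s \<in> T" "t \<in> T" "s \<noteq> t" for s t
  proof -
    have "(+) s ` \<Omega> \<noteq> (+) t ` \<Omega>" using T(1) that by (auto simp: inj_on_def)
    then have "negligible ((+) s ` \<Omega> \<inter> (+) t ` \<Omega>)"
      using T0(1) that unfolding T(2) by (auto simp: pairwise_def)
    then have "negligible ((+) s ` W \<inter> (+) t ` W)"
      by (rule negligible_subset) (use W\<Omega> in auto)
    moreover have "open ((+) s ` W \<inter> (+) t ` W)"
      by (intro open_Int open_translation openW)
    ultimately show ?thesis using open_not_negligible by blast
  qed
  have injW: "inj_on (\<lambda>t. (+) t ` W) T"
  proof (rule inj_onI, rule ccontr)
    fix s t assume "s \<in> T" "t \<in> T" "(+) s ` W = (+) t ` W" "s \<noteq> t"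
    then show False using disj[of s t] \<open>W \<noteq> {}\<close> by auto
  qed
  \<comment> \<open>Countability makes the union of the boundaries of all tiles a null set.\<close>
  have "countable ((\<lambda>t. (+) t ` W) ` T)"
    by (rule countable_disjoint_open_subsets)
       (use disj in \<open>auto simp: pairwise_def disjnt_def intro: open_translation openW\<close>)
  then have "countable T" using injW by (rule countable_image_inj_on)
  define Z where "Z = - (\<Union>t\<in>T. (+) t ` W)"
  have negZ: "negligible Z"
  proof (rule negligible_subset)
    have "negligible ((+) t ` (\<Omega> - W))" for t by (rule negligible_translation[OF negl])
    then have "negligible (\<Union>t\<in>T. (+) t ` (\<Omega> - W))"
      using \<open>countable T\<close> by (intro negligible_countable_Union countable_image) blast+
    then show "negligible (- (\<Union>t\<in>T0. (+) t ` \<Omega>) \<union> (\<Union>t\<in>T. (+) t ` (\<Omega> - W)))"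
      using T0(2) by (intro negligible_Un)
    show "Z \<subseteq> - (\<Union>t\<in>T0. (+) t ` \<Omega>) \<union> (\<Union>t\<in>T. (+) t ` (\<Omega> - W))"
      unfolding T(2) by (auto simp: Z_def)
  qed
  have "negligible (\<Union>v\<in>(UNIV :: (int ^ 'n) set). (+) (- int_vec v) ` Z)"
  proof (rule negligible_countable_Union)
    show "countable (range (\<lambda>v :: int ^ 'n. (+) (- int_vec v) ` Z))"
      by (intro countable_image) simp
    fix Y assume "Y \<in> range (\<lambda>v :: int ^ 'n. (+) (- int_vec v) ` Z)"
    then obtain v :: "int ^ 'n" where "Y = (+) (- int_vec v) ` Z" by blast
    then show "negligible Y" using negligible_translation[OF negZ] by (simp only:)
  qed
  then obtain x where x: "\<And>v. x \<notin> (+) (- int_vec v) ` Z"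
    using non_negligible_UNIV by (metis (no_types, lifting) UNIV_I UNIV_eq_I UN_iff)
  have cover: "\<exists>t\<in>T. x + int_vec v \<in> (+) t ` W" for v
  proof (rule ccontr)
    assume "\<not> ?thesis"
    then have "x + int_vec v \<in> Z" by (simp add: Z_def)
    then have "x \<in> (+) (- int_vec v) ` Z" by (intro image_eqI[of _ _ "x + int_vec v"]) auto
    then show False using x by blast
  qed
  \<comment> \<open>If the coset meets the open unit cube at \<open>t\<close> in the point with index \<open>s\<close>, then its points in the
    open cubes of the tile at \<open>t\<close> have the indices \<open>s + a\<close> with \<open>a \<in> A\<close>.\<close>
  define S where "S = {s. \<exists>t\<in>T. x + int_vec s - t \<in> box 0 1}"
  have "\<exists>!s. s \<in> S \<and> y - s \<in> A" for y
  proof (rule ex_ex1I)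
    from cover[of y] obtain t a z where
      t: "t \<in> T" "a \<in> A" "z \<in> box 0 1" "x + int_vec y = t + (int_vec a + z)"
      by (auto simp: W_def)
    have "x + int_vec (y - a) - t = z" using t(4) by (simp add: int_vec_diff algebra_simps)
    then have "y - a \<in> S" using t by (auto simp: S_def)
    then show "\<exists>s. s \<in> S \<and> y - s \<in> A" using t(2) by (intro exI[of _ "y - a"]) simp
  next
    fix s s' assume s: "s \<in> S \<and> y - s \<in> A" and s': "s' \<in> S \<and> y - s' \<in> A"
    from s obtain t where t: "t \<in> T" "x + int_vec s - t \<in> box 0 1" by (auto simp: S_def)
    from s' obtain t' where t': "t' \<in> T" "x + int_vec s' - t' \<in> box 0 1" by (auto simp: S_def)
    have mem: "x + int_vec y \<in> (+) t ` W" if "x + int_vec s - t \<in> box 0 1" "y - s \<in> A" for s t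
    proof -
      have "x + int_vec y = t + (int_vec (y - s) + (x + int_vec s - t))"
        by (simp add: int_vec_diff)
      then show ?thesis using that unfolding W_def by blast
    qed
    have "t = t'"
      using disj[OF t(1) t'(1)] mem[OF t(2)] mem[OF t'(2)] s s' by blast
    have "s $ i = s' $ i" for i
    proof -
      have "0 < x $ i + of_int (s $ i) - t $ i" "x $ i + of_int (s $ i) - t $ i < 1"
           "0 < x $ i + of_int (s' $ i) - t $ i" "x $ i + of_int (s' $ i) - t $ i < 1"
        using t(2) t'(2) \<open>t = t'\<close> by (simp_all add: mem_box_cart)
      then have "\<bar>real_of_int (s $ i) - of_int (s' $ i)\<bar> < 1" by linarith
      then show ?thesis by linarith
    qed
    then show "s = s'" by (simp add: vec_eq_iff)
  qed
  then show ?thesis by blast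
qed

section \<open>The thickened simplex\<close>

definition simplex_vertices :: "'n::finite set \<Rightarrow> (int ^ 'n) set" where
  "simplex_vertices I = insert 0 ((\<lambda>i. axis i 1) ` I)"

text \<open>The vertices of the simplex are pairwise incongruent modulo 3. Thickening adds a large box in the
sublattice of multiples of 3, so that modulo 3 nothing changes while the set looks 3-periodic at most
places.\<close>

definition thick_simplex :: "'n::finite set \<Rightarrow> nat \<Rightarrow> (int ^ 'n) set" where
  "thick_simplex I M = (\<lambda>(d, k). d + 3 *s k) ` (simplex_vertices I \<times> lattice_box M)"

lemma simplex_vertices_nth: "d \<in> simplex_vertices I \<Longrightarrow> d $ i = 0 \<or> d $ i = 1"
  by (auto simp: simplex_vertices_def axis_def)

lemma card_simplex_vertices: "card (simplex_vertices I) = Suc (card I)"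
proof -
  have "inj_on (\<lambda>i. axis i (1 :: int)) I" by (auto simp: inj_on_def axis_eq_axis)
  moreover have "0 \<notin> (\<lambda>i. axis i (1 :: int)) ` I" by (auto simp: axis_eq_0_iff)
  ultimately show ?thesis by (simp add: simplex_vertices_def card_image)
qed

lemma finite_simplex_vertices: "finite (simplex_vertices I)"
  by (simp add: simplex_vertices_def)

lemma thick_simplex_decomp_unique:
  assumes "d \<in> simplex_vertices I" "d' \<in> simplex_vertices I" "d + 3 *s k = d' + 3 *s k'"
  shows "d = d' \<and> k = k'"
proof -
  have "d $ i = d' $ i \<and> k $ i = k' $ i" for i
  proof -
    have "d $ i + 3 * k $ i = d' $ i + 3 * k' $ i"
      using arg_cong[OF assms(3), of "\<lambda>v. v $ i"] by simp
    then show ?thesis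
      using simplex_vertices_nth[OF assms(1), of i] simplex_vertices_nth[OF assms(2), of i] by presburger
  qed
  then show ?thesis by (simp add: vec_eq_iff)
qed

lemma finite_thick_simplex: "finite (thick_simplex I M)"
  by (simp add: thick_simplex_def finite_lattice_box finite_simplex_vertices)

lemma thick_simplex_nonempty: "M > 0 \<Longrightarrow> thick_simplex I M \<noteq> {}"
proof -
  assume "M > 0"
  then have "(0 :: int ^ 'a) \<in> lattice_box M" by (simp add: lattice_box_def)
  then show ?thesis by (auto simp: thick_simplex_def simplex_vertices_def)
qed

lemma sum_thick_simplex:
  "(\<Sum>a\<in>thick_simplex I M. F a) = (\<Sum>d\<in>simplex_vertices I. \<Sum>k\<in>lattice_box M. F (d + 3 *s k))"
proof -
  have "inj_on (\<lambda>(d, k). d + 3 *s k) (simplex_vertices I \<times> lattice_box M)"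
    by (auto simp: inj_on_def dest: thick_simplex_decomp_unique)
  then show ?thesis
    by (simp add: thick_simplex_def sum.reindex sum.cartesian_product case_prod_unfold)
qed

section \<open>The thickened simplex does not tile the lattice\<close>

text \<open>In a tiling with translations \<open>S\<close>, the set \<open>G = S + 3 * lattice_box M\<close> contains, for each \<open>y\<close>, exactly
one of the points \<open>y - d\<close> for \<open>d\<close> a vertex of the simplex. If \<open>G\<close> were 3-periodic, then \<open>d\<close> would not
affect how many points \<open>y\<close> of a block \<open>Y\<close> of side 3 satisfy \<open>y - d \<in> G\<close>, and counting \<open>Y\<close> would show that
the number of vertices divides \<open>3 ^ CARD('n)\<close>.

Periodicity is only needed next to the one block \<open>Y\<close>, and there it can be arranged. Inside the box \<open>B\<close> of
side \<open>3 * M\<close>, periodicity in direction \<open>i\<close> fails only at the two ends of the boxes \<open>s + 3 * lattice_box M\<close>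
that meet \<open>B\<close>. The set \<open>R\<close> of these \<open>s\<close> has at most \<open>6 ^ CARD('n)\<close> elements, because such an \<open>s\<close> is
determined by its residues modulo 3 and by the signs of its coordinates. As \<open>B\<close> has almost \<open>3 * M\<close>
positions in each direction and at most \<open>2 * M\<close> of them are cuts, some position is no cut.\<close>

lemma no_lattice_tiling_thick_simplex:
  fixes I :: "'n::finite set"
  assumes ndvd: "\<not> Suc (card I) dvd 3 ^ CARD('n)" and M: "M = 6 ^ CARD('n)"
  shows "\<not> (\<exists>S. \<forall>y. \<exists>!s. s \<in> S \<and> y - s \<in> thick_simplex I M)"
proof
  assume "\<exists>S. \<forall>y. \<exists>!s. s \<in> S \<and> y - s \<in> thick_simplex I M"
  then obtain S where tile: "\<And>y. \<exists>!s. s \<in> S \<and> y - s \<in> thick_simplex I M" by blast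
  have tile_unique: "s = s'" if "s \<in> S" "s' \<in> S" "y - s \<in> thick_simplex I M" "y - s' \<in> thick_simplex I M" for s s' y
    using tile[of y] that by blast
  have M_pos: "M > 0" by (simp add: M)
  have M6: "M \<ge> 6"
    unfolding M using power_increasing[of 1 "CARD('n)" "6 :: nat"] by (simp add: Suc_leI)
  define G where "G = {s + 3 *s k | s k. s \<in> S \<and> k \<in> lattice_box M}"
  define B where "B = {x :: int ^ 'n. \<forall>i. 0 \<le> x $ i \<and> x $ i < 3 * int M}"
  define R where "R = {s \<in> S. \<exists>k\<in>lattice_box M. s + 3 *s k \<in> B}"

  have vertex_ex1: "\<exists>!d. d \<in> simplex_vertices I \<and> y - d \<in> G" for y
  proof (rule ex_ex1I)
    from tile[of y] obtain s where s: "s \<in> S" "y - s \<in> thick_simplex I M" by blast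
    then obtain d k where dk: "d \<in> simplex_vertices I" "k \<in> lattice_box M" "y - s = d + 3 *s k"
      by (auto simp: thick_simplex_def)
    then have "y - d = s + 3 *s k" by (simp add: algebra_simps)
    then show "\<exists>d. d \<in> simplex_vertices I \<and> y - d \<in> G"
      using s dk unfolding G_def by blast
  next
    fix d d' assume d: "d \<in> simplex_vertices I \<and> y - d \<in> G" and d': "d' \<in> simplex_vertices I \<and> y - d' \<in> G"
    obtain s k where sk: "s \<in> S" "k \<in> lattice_box M" "y - d = s + 3 *s k" using d by (auto simp: G_def)
    obtain s' k' where sk': "s' \<in> S" "k' \<in> lattice_box M" "y - d' = s' + 3 *s k'" using d' by (auto simp: G_def)
    have y: "y - s = d + 3 *s k" "y - s' = d' + 3 *s k'" using sk(3) sk'(3) by (auto simp: algebra_simps)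
    have "y - s \<in> thick_simplex I M" "y - s' \<in> thick_simplex I M"
      unfolding y thick_simplex_def using d d' sk(2) sk'(2) by auto
    then have "s = s'" using tile_unique sk(1) sk'(1) by blast
    then show "d = d'" using thick_simplex_decomp_unique[of d I d' k k'] d d' y by simp
  qed

  have R_bounds: "- 3 * int M < s $ i \<and> s $ i < 3 * int M" if "s \<in> R" for s i
  proof -
    from that obtain k where "k \<in> lattice_box M" "s + 3 *s k \<in> B" by (auto simp: R_def)
    then have "0 \<le> k $ i" "k $ i < int M" "0 \<le> s $ i + 3 * k $ i" "s $ i + 3 * k $ i < 3 * int M"
      by (auto simp: lattice_box_def B_def)
    then show ?thesis by linarith
  qed
  \<comment> \<open>Two boxes with equal keys are congruent modulo 3 and offset by less than their side length in each
    direction, hence share the point \<open>p\<close>; disjointness of the tiles makes them equal.\<close>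
  define key where "key s = (\<lambda>i. (s $ i mod 3, s $ i < 0))" for s :: "int ^ 'n"
  have inj_key: "inj_on key R"
  proof (rule inj_onI)
    fix s s' assume s: "s \<in> R" and s': "s' \<in> R" and eq: "key s = key s'"
    have key_eq: "s $ i mod 3 = s' $ i mod 3" "s $ i < 0 \<longleftrightarrow> s' $ i < 0" for i
      using fun_cong[OF eq, of i] by (simp_all add: key_def)
    define p :: "int ^ 'n" where "p = (\<chi> i. max (s $ i) (s' $ i))"
    have p: "p - t \<in> thick_simplex I M" if t: "t = s \<or> t = s'" for t
    proof -
      define k :: "int ^ 'n" where "k = (\<chi> i. (p $ i - t $ i) div 3)"
      have k: "p $ i - t $ i = 3 * k $ i \<and> 0 \<le> k $ i \<and> k $ i < int M" for i
      proof -
        have "3 dvd p $ i - t $ i"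
          using t key_eq(1)[of i] by (auto simp: p_def max_def mod_eq_dvd_iff dvd_diff_commute)
        moreover have "0 \<le> p $ i - t $ i" using t by (auto simp: p_def)
        moreover have "p $ i - t $ i < 3 * int M"
          using t R_bounds[OF s, of i] R_bounds[OF s', of i] key_eq(2)[of i]
          by (auto simp: p_def max_def)
        ultimately show ?thesis by (auto simp: k_def)
      qed
      have "p - t = 0 + 3 *s k" using k by (simp add: vec_eq_iff)
      moreover have "(0, k) \<in> simplex_vertices I \<times> lattice_box M"
        using k by (simp add: lattice_box_def simplex_vertices_def)
      ultimately show ?thesis
        unfolding thick_simplex_def by (intro image_eqI[of _ _ "(0, k)"]) simp_all
    qed
    show "s = s'" using tile_unique[of s s' p] p s s' by (auto simp: R_def)
  qed
  have key_range: "key ` R \<subseteq> (\<Pi>\<^sub>E i\<in>UNIV. {0..<3::int} \<times> UNIV)"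
    by (auto simp: key_def)
  have fin_range: "finite (\<Pi>\<^sub>E i\<in>(UNIV :: 'n set). {0..<3::int} \<times> (UNIV :: bool set))"
    by (intro finite_PiE) auto
  have fin_R: "finite R"
    using inj_key finite_subset[OF key_range fin_range] by (simp add: finite_image_iff)
  have "card R = card (key ` R)" using inj_key by (simp add: card_image)
  also have "\<dots> \<le> card (\<Pi>\<^sub>E i\<in>(UNIV :: 'n set). {0..<3::int} \<times> (UNIV :: bool set))"
    by (rule card_mono[OF fin_range key_range])
  also have "\<dots> = M" by (simp add: card_PiE card_cartesian_product M)
  finally have card_R: "card R \<le> M" .

  \<comment> \<open>The positions \<open>z $ i\<close> for which a step by 3 in direction \<open>i\<close> may enter or leave a box.\<close>
  define cuts where "cuts i = (\<lambda>s. s $ i - 3) ` R \<union> (\<lambda>s. s $ i + 3 * (int M - 1)) ` R" for i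
  \<comment> \<open>The block \<open>Y\<close> starts at \<open>v i + 1\<close>, and the bound keeps \<open>v i + 3\<close> within the box \<open>B\<close>.\<close>
  have "\<exists>v\<in>{0..3 * int M - 4}. v \<notin> cuts i" for i
  proof (rule ccontr)
    assume "\<not> ?thesis"
    then have "{0..3 * int M - 4} \<subseteq> cuts i" by blast
    then have "card {0..3 * int M - 4} \<le> card (cuts i)"
      by (rule card_mono[rotated]) (simp add: cuts_def fin_R)
    also have "\<dots> \<le> card ((\<lambda>s. s $ i - 3) ` R) + card ((\<lambda>s. s $ i + 3 * (int M - 1)) ` R)"
      unfolding cuts_def by (rule card_Un_le)
    also have "\<dots> \<le> M + M"
      using card_R card_image_le[OF fin_R] by (meson add_mono order_trans)
    finally show False using M6 by simp
  qed
  then obtain v where v: "\<And>i. v i \<in> {0..3 * int M - 4}" "\<And>i. v i \<notin> cuts i" by metis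
  define u :: "int ^ 'n" where "u = (\<chi> i. v i + 1)"
  define Y where "Y = {y :: int ^ 'n. \<forall>i. u $ i \<le> y $ i \<and> y $ i < u $ i + 3}"
  have u: "1 \<le> u $ i" "u $ i + 3 \<le> 3 * int M" for i
    using v(1)[of i] by (auto simp: u_def)

  have shift: "z \<in> G \<longleftrightarrow> z + 3 *s axis i 1 \<in> G"
    if zi: "z $ i = u $ i - 1" and z: "\<And>j. j \<noteq> i \<Longrightarrow> u $ j \<le> z $ j \<and> z $ j < u $ j + 3" for z i
  proof -
    have B: "z \<in> B" "z + 3 *s axis i 1 \<in> B"
    proof -
      have "0 \<le> z $ j \<and> z $ j + 3 * axis i 1 $ j < 3 * int M \<and> z $ j < 3 * int M" for j
        using z[of j] zi u[of j] by (cases "j = i") (auto simp: axis_def)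
      moreover have "0 \<le> (axis i 1 :: int ^ 'n) $ j" for j by (simp add: axis_def)
      ultimately show "z \<in> B" "z + 3 *s axis i 1 \<in> B" by (auto simp: B_def add_nonneg_nonneg)
    qed
    have notin: "z $ i \<noteq> s $ i - 3" "z $ i \<noteq> s $ i + 3 * (int M - 1)" if "s \<in> R" for s
      using v(2)[of i] that zi by (auto simp: cuts_def u_def)
    show ?thesis
    proof
      assume "z \<in> G"
      then obtain s k where sk: "s \<in> S" "k \<in> lattice_box M" "z = s + 3 *s k" by (auto simp: G_def)
      then have "s \<in> R" using B(1) by (auto simp: R_def)
      then have "k $ i \<noteq> int M - 1" using notin(2)[of s] sk(3) by auto
      moreover have k: "0 \<le> k $ j" "k $ j < int M" for j
        using sk(2) by (simp_all add: lattice_box_def)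
      ultimately have "k $ i + 1 < int M" using k(2)[of i] by linarith
      then have "0 \<le> (k + axis i 1) $ j \<and> (k + axis i 1) $ j < int M" for j
        using k[of j] by (cases "j = i") (simp_all add: axis_def)
      then have "k + axis i 1 \<in> lattice_box M" by (simp add: lattice_box_def)
      moreover have "z + 3 *s axis i 1 = s + 3 *s (k + axis i 1)"
        by (simp add: sk(3) vec_eq_iff algebra_simps)
      ultimately show "z + 3 *s axis i 1 \<in> G" using sk(1) unfolding G_def by blast
    next
      assume "z + 3 *s axis i 1 \<in> G"
      then obtain s k where sk: "s \<in> S" "k \<in> lattice_box M" "z + 3 *s axis i 1 = s + 3 *s k" by (auto simp: G_def)
      then have "s \<in> R" using B(2) by (auto simp: R_def)
      have "z $ i + 3 = s $ i + 3 * k $ i"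
        using arg_cong[OF sk(3), of "\<lambda>v. v $ i"] by simp
      then have "k $ i \<noteq> 0" using notin(1)[OF \<open>s \<in> R\<close>] by auto
      moreover have k: "0 \<le> k $ j" "k $ j < int M" for j
        using sk(2) by (simp_all add: lattice_box_def)
      ultimately have "1 \<le> k $ i" using k(1)[of i] by linarith
      then have "0 \<le> (k - axis i 1) $ j \<and> (k - axis i 1) $ j < int M" for j
        using k[of j] by (cases "j = i") (simp_all add: axis_def)
      then have "k - axis i 1 \<in> lattice_box M" by (simp add: lattice_box_def)
      moreover have "z = s + 3 *s (k - axis i 1)"
      proof -
        have "z = s + 3 *s k - 3 *s axis i 1" by (simp flip: sk(3))
        then show ?thesis by (simp add: vec_eq_iff algebra_simps)
      qed
      ultimately show "z \<in> G" using sk(1) unfolding G_def by blast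
    qed
  qed

  have Y_eq: "Y = (+) u ` lattice_box 3"
  proof -
    have "y \<in> Y \<longleftrightarrow> y - u \<in> lattice_box 3" for y
      by (auto simp: Y_def lattice_box_def algebra_simps)
    moreover have "y \<in> (+) u ` lattice_box 3 \<longleftrightarrow> y - u \<in> lattice_box 3" for y
      by (auto intro: image_eqI[of _ _ "y - u"])
    ultimately show ?thesis by blast
  qed
  have fin_Y: "finite Y" by (simp add: Y_eq finite_lattice_box)
  have card_Y: "card Y = 3 ^ CARD('n)" by (simp add: Y_eq card_image card_lattice_box)

  have card_shift: "card {y \<in> Y. y - d \<in> G} = card {y \<in> Y. y \<in> G}" if d: "d \<in> simplex_vertices I" for d
  proof (cases "d = 0")
    case False
    then obtain i where i: "d = axis i 1" using d by (auto simp: simplex_vertices_def)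
    \<comment> \<open>Subtracting the unit vector, with the layer that leaves the block moved back by 3 to its opposite side.\<close>
    define \<phi> where "\<phi> y = (if y $ i = u $ i then y + 2 *s axis i 1 else y - axis i 1)" for y
    define \<psi> where "\<psi> y = (if y $ i = u $ i + 2 then y - 2 *s axis i 1 else y + axis i 1)" for y
    have YI: "y \<in> Y \<longleftrightarrow> u $ i \<le> y $ i \<and> y $ i < u $ i + 3 \<and> (\<forall>j. j \<noteq> i \<longrightarrow> u $ j \<le> y $ j \<and> y $ j < u $ j + 3)"
      (is "_ \<longleftrightarrow> ?R") for y
    proof
      assume ?R
      then have "u $ j \<le> y $ j \<and> y $ j < u $ j + 3" for j by (cases "j = i") auto
      then show "y \<in> Y" by (simp add: Y_def)
    qed (simp add: Y_def)
    have ax: "(axis i 1 :: int ^ 'n) $ j = (if j = i then 1 else 0)" for j by (simp add: axis_def)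
    have inG: "y - axis i 1 \<in> G \<longleftrightarrow> \<phi> y \<in> G" if "y \<in> Y" for y
    proof (cases "y $ i = u $ i")
      case True
      have "y - axis i 1 + 3 *s axis i 1 = \<phi> y" using True by (simp add: \<phi>_def vec_eq_iff ax)
      moreover have "y - axis i 1 \<in> G \<longleftrightarrow> y - axis i 1 + 3 *s axis i 1 \<in> G"
        using that True by (intro shift) (auto simp: YI ax)
      ultimately show ?thesis by simp
    qed (simp add: \<phi>_def)
    have "bij_betw \<phi> {y \<in> Y. y - d \<in> G} {y \<in> Y. y \<in> G}"
    proof (rule bij_betw_byWitness[where f'=\<psi>])
      show "\<forall>y\<in>{y \<in> Y. y - d \<in> G}. \<psi> (\<phi> y) = y"
        by (auto simp: \<phi>_def \<psi>_def vec_eq_iff ax YI)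
      show "\<forall>y\<in>{y \<in> Y. y \<in> G}. \<phi> (\<psi> y) = y"
        by (auto simp: \<phi>_def \<psi>_def vec_eq_iff ax YI)
      have \<phi>Y: "\<phi> y \<in> Y" if "y \<in> Y" for y
        using that by (auto simp: \<phi>_def YI ax)
      show "\<phi> ` {y \<in> Y. y - d \<in> G} \<subseteq> {y \<in> Y. y \<in> G}"
        using \<phi>Y inG by (auto simp: i)
      have \<psi>Y: "\<psi> y \<in> Y \<and> \<phi> (\<psi> y) = y" if "y \<in> Y" for y
        using that by (auto simp: \<phi>_def \<psi>_def YI ax vec_eq_iff)
      show "\<psi> ` {y \<in> Y. y \<in> G} \<subseteq> {y \<in> Y. y - d \<in> G}"
        using \<psi>Y inG by (auto simp: i)
    qed
    then show ?thesis by (rule bij_betw_same_card)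
  qed simp

  have "Y = (\<Union>d\<in>simplex_vertices I. {y \<in> Y. y - d \<in> G})"
  proof (intro equalityI subsetI)
    fix y assume "y \<in> Y"
    moreover from vertex_ex1[of y] obtain d where "d \<in> simplex_vertices I" "y - d \<in> G" by blast
    ultimately show "y \<in> (\<Union>d\<in>simplex_vertices I. {y \<in> Y. y - d \<in> G})" by blast
  qed blast
  then have "card Y = card (\<Union>d\<in>simplex_vertices I. {y \<in> Y. y - d \<in> G})" by simp
  also have "\<dots> = (\<Sum>d\<in>simplex_vertices I. card {y \<in> Y. y - d \<in> G})"
  proof (rule card_UN_disjoint)
    have "d = d'" if "d \<in> simplex_vertices I" "d' \<in> simplex_vertices I" "y - d \<in> G" "y - d' \<in> G" for d d' y
      using vertex_ex1[of y] that by blast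
    then show "\<forall>d\<in>simplex_vertices I. \<forall>d'\<in>simplex_vertices I.
        d \<noteq> d' \<longrightarrow> {y \<in> Y. y - d \<in> G} \<inter> {y \<in> Y. y - d' \<in> G} = {}"
      by blast
  qed (simp_all add: fin_Y finite_simplex_vertices)
  also have "\<dots> = (\<Sum>d\<in>simplex_vertices I. card {y \<in> Y. y \<in> G})"
    using card_shift by (intro sum.cong refl)
  also have "\<dots> = Suc (card I) * card {y \<in> Y. y \<in> G}"
    by (simp add: card_simplex_vertices)
  finally show False using ndvd card_Y by (metis dvd_triv_left)
qed

section \<open>The thickened simplex is spectral\<close>

lemma character_scaleR_commute: "character (c *\<^sub>R \<xi>) x = character \<xi> (c *\<^sub>R x)"
  by (simp add: character_def)

lemma int_vec_smult: "int_vec (c *s k) = of_int c *\<^sub>R int_vec k"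
  by (simp add: vec_eq_iff)

text \<open>The five coordinates in \<open>I\<close> and the origin index the columns of the Hadamard matrix, and the rows define
frequencies \<open>\<xi> l\<close>. The spectrum modulo 1 consists of \<open>\<xi> l / 3 + m / (3 * M)\<close>. Row orthogonality: as the
frequencies \<open>\<xi> l / 3\<close> are trivial on multiples of 3, the character sum is a sum over the simplex times a
sum over the box, and one of the factors vanishes. Column orthogonality is similar, with the sum over \<open>m\<close>
for points with the same vertex and the sum over \<open>l\<close> for points with distinct vertices.\<close>

lemma spectral_thick_simplex:
  fixes I :: "'n::finite set"
  assumes I: "card I = 5" and M: "M > 0"
  shows "\<exists>\<Lambda>. is_spectrum \<Lambda> (cube_union (thick_simplex I M))"
proof -
  obtain p where p: "bij_betw p {1..5 :: nat} I"
    using ex_bij_betw_nat_finite_1[of I] I by auto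
  define \<omega> :: "nat \<Rightarrow> int ^ 'n" where "\<omega> j = (if j = 0 then 0 else axis (p j) 1)" for j
  define \<xi> :: "nat \<Rightarrow> int ^ 'n" where "\<xi> l = (\<Sum>j\<in>{1..5}. butson6 l j *s axis (p j) 1)" for l
  have p_inj: "p j = p j' \<longleftrightarrow> j = j'" if "j \<in> {1..5}" "j' \<in> {1..5}" for j j'
    using p that by (auto simp: bij_betw_def inj_on_def)
  have \<omega>: "bij_betw \<omega> {..<6} (simplex_vertices I)"
  proof -
    have "inj_on \<omega> {..<6}"
      using p_inj by (auto simp: inj_on_def \<omega>_def axis_eq_axis axis_eq_0_iff split: if_splits)
    moreover have "{..<6} = insert 0 {1..5::nat}" by auto
    then have "\<omega> ` {..<6} = insert 0 ((\<lambda>i. axis i 1) ` p ` {1..5})"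
      by (auto simp: \<omega>_def image_image)
    then have "\<omega> ` {..<6} = simplex_vertices I"
      using p by (simp add: simplex_vertices_def bij_betw_def)
    ultimately show ?thesis by (simp add: bij_betw_def)
  qed
  have pairing: "int_vec (\<xi> l) \<bullet> int_vec (\<omega> j) = of_int (butson6 l j)" if "l < 6" "j < 6" for l j
  proof (cases "j = 0")
    case True
    then show ?thesis using that by (simp add: \<omega>_def butson6_0)
  next
    case False
    then have j: "j \<in> {1..5}" using that by auto
    have "int_vec (\<omega> j) = axis (p j) 1"
      using False by (auto simp: \<omega>_def vec_eq_iff axis_def)
    then have "int_vec (\<xi> l) \<bullet> int_vec (\<omega> j) = of_int (\<xi> l $ p j)" by (simp add: inner_axis)
    also have "\<xi> l $ p j = (\<Sum>j'\<in>{1..5}. if j' = j then butson6 l j' else 0)"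
      unfolding \<xi>_def sum_component using p_inj[OF j]
      by (intro sum.cong) (auto simp: axis_def)
    also have "\<dots> = butson6 l j" using j by (simp del: One_nat_def)
    finally show ?thesis .
  qed
  define J where "J = {..<6::nat} \<times> (lattice_box M :: (int ^ 'n) set)"
  define \<beta> where "\<beta> = (\<lambda>(l, m). (1 / 3) *\<^sub>R int_vec (\<xi> l) + (1 / (3 * real M)) *\<^sub>R int_vec m)"
  have "is_spectrum {\<beta> q + int_vec k | q k. q \<in> J} (cube_union (thick_simplex I M))"
  proof (rule is_spectrum_cube_union)
    show "finite (thick_simplex I M)" "thick_simplex I M \<noteq> {}"
      by (simp_all add: finite_thick_simplex thick_simplex_nonempty M)
    have "(0 :: int ^ 'n) \<in> lattice_box M" using M by (simp add: lattice_box_def)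
    then have "(0, 0) \<in> J" by (simp add: J_def)
    then show "J \<noteq> {}" by blast
    show "finite J" by (simp add: J_def finite_lattice_box)
  next
    fix q q' assume q: "q \<in> J" "q' \<in> J" "q \<noteq> q'"
    obtain l m l' m' where lm: "q = (l, m)" "q' = (l', m')" by (metis surj_pair)
    have l: "l < 6" "l' < 6" and m: "m \<in> lattice_box M" "m' \<in> lattice_box M"
      using q by (auto simp: J_def lm)
    define \<theta> where "\<theta> = \<beta> q - \<beta> q'"
    have \<theta>: "\<theta> = (1 / 3) *\<^sub>R int_vec (\<xi> l - \<xi> l') + (1 / 3) *\<^sub>R ((1 / real M) *\<^sub>R int_vec (m - m'))"
      by (simp add: \<theta>_def \<beta>_def lm int_vec_diff algebra_simps)
    have period: "character \<theta> (int_vec (d + 3 *s k)) =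
        character \<theta> (int_vec d) * character ((1 / real M) *\<^sub>R int_vec (m - m')) (int_vec k)" for d k
    proof -
      have "character \<theta> (int_vec (3 *s k)) =
            character ((1 / 3) *\<^sub>R int_vec (\<xi> l - \<xi> l')) (3 *\<^sub>R int_vec k) *
            character ((1 / 3) *\<^sub>R ((1 / real M) *\<^sub>R int_vec (m - m'))) (3 *\<^sub>R int_vec k)"
        by (simp only: \<theta> character_add_left int_vec_smult of_int_numeral)
      also have "\<dots> = character ((1 / real M) *\<^sub>R int_vec (m - m')) (int_vec k)"
        by (subst (1 2) character_scaleR_commute) (simp add: character_int_vec)
      finally show ?thesis by (simp add: int_vec_add character_add_right)
    qed
    have "(\<Sum>a\<in>thick_simplex I M. character \<theta> (int_vec a)) =
       (\<Sum>d\<in>simplex_vertices I. character \<theta> (int_vec d)) *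
       (\<Sum>k\<in>lattice_box M. character ((1 / real M) *\<^sub>R int_vec (m - m')) (int_vec k))"
      by (simp only: sum_thick_simplex period sum_product)
    also have "\<dots> = 0"
    proof (cases "m = m'")
      case False
      then show ?thesis by (simp only: character_sum_lattice_box[OF m False] mult_zero_right)
    next
      case True
      then have "l \<noteq> l'" using q(3) lm by simp
      have "(\<Sum>d\<in>simplex_vertices I. character \<theta> (int_vec d)) = (\<Sum>j<6. character \<theta> (int_vec (\<omega> j)))"
        by (rule sum.reindex_bij_betw[OF \<omega>, symmetric])
      also have "\<dots> = (\<Sum>j<6. cis (2 * pi * (of_int (butson6 l j - butson6 l' j) / 3)))"
        using l pairing True
        by (intro sum.cong) (auto simp: \<theta> character_def int_vec_diff inner_diff_left)
      also have "\<dots> = 0" using butson6_orthogonal l \<open>l \<noteq> l'\<close> by blast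
      finally show ?thesis by simp
    qed
    finally show "(\<Sum>a\<in>thick_simplex I M. character (\<beta> q - \<beta> q') (int_vec a)) = 0"
      by (simp only: \<theta>_def)
  next
    fix a b assume a: "a \<in> thick_simplex I M" and b: "b \<in> thick_simplex I M" and "a \<noteq> b"
    have "simplex_vertices I = \<omega> ` {..<6}" using \<omega> by (simp add: bij_betw_def)
    with a b obtain j k j' k' where jk: "j < 6" "k \<in> lattice_box M" "a = \<omega> j + 3 *s k"
      "j' < 6" "k' \<in> lattice_box M" "b = \<omega> j' + 3 *s k'"
      by (auto simp: thick_simplex_def)
    have ab: "int_vec (a - b) = (int_vec (\<omega> j) - int_vec (\<omega> j')) + 3 *\<^sub>R int_vec (k - k')"
      by (simp add: jk int_vec_diff int_vec_add int_vec_smult algebra_simps)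
    have "(\<Sum>q\<in>J. character (\<beta> q) (int_vec (a - b))) =
       (\<Sum>l<6. character ((1 / 3) *\<^sub>R int_vec (\<xi> l)) (int_vec (a - b))) *
       (\<Sum>m\<in>lattice_box M. character ((1 / (3 * real M)) *\<^sub>R int_vec m) (int_vec (a - b)))"
      by (simp add: J_def \<beta>_def sum_product sum.cartesian_product character_add_left case_prod_unfold)
    also have "\<dots> = 0"
    proof (cases "j = j'")
      case False
      have "character ((1 / 3) *\<^sub>R int_vec (\<xi> l)) (int_vec (a - b)) =
            cis (2 * pi * (of_int (butson6 j l - butson6 j' l) / 3))" if "l < 6" for l
      proof -
        have "character ((1 / 3) *\<^sub>R int_vec (\<xi> l)) (int_vec (a - b)) =
          character ((1 / 3) *\<^sub>R int_vec (\<xi> l)) (int_vec (\<omega> j) - int_vec (\<omega> j')) *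
          character (int_vec (\<xi> l)) ((1 / 3) *\<^sub>R (3 *\<^sub>R int_vec (k - k')))"
          by (simp only: ab character_add_right character_scaleR_commute[symmetric])
        moreover have "character (int_vec (\<xi> l)) ((1 / 3) *\<^sub>R (3 *\<^sub>R int_vec (k - k'))) = 1"
          by (simp add: character_int_vec)
        moreover have "character ((1 / 3) *\<^sub>R int_vec (\<xi> l)) (int_vec (\<omega> j) - int_vec (\<omega> j')) =
            cis (2 * pi * (of_int (butson6 j l - butson6 j' l) / 3))"
          using that jk(1,4) pairing[of l j] pairing[of l j'] butson6_sym[of j l] butson6_sym[of j' l]
          by (simp add: character_def inner_diff_right diff_divide_distrib)
        ultimately show ?thesis by simp
      qed
      then have "(\<Sum>l<6. character ((1 / 3) *\<^sub>R int_vec (\<xi> l)) (int_vec (a - b))) =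
        (\<Sum>l<6. cis (2 * pi * (of_int (butson6 j l - butson6 j' l) / 3)))" by (intro sum.cong) auto
      also have "\<dots> = 0" using butson6_orthogonal jk(1,4) False by blast
      finally show ?thesis by simp
    next
      case True
      then have "k \<noteq> k'" using \<open>a \<noteq> b\<close> jk by auto
      have "character ((1 / (3 * real M)) *\<^sub>R int_vec m) (int_vec (a - b)) =
            character ((1 / real M) *\<^sub>R int_vec (k - k')) (int_vec m)" for m
        by (simp add: ab True character_def inner_commute)
      then have "(\<Sum>m\<in>lattice_box M. character ((1 / (3 * real M)) *\<^sub>R int_vec m) (int_vec (a - b))) = 0"
        using character_sum_lattice_box[OF jk(2,5) \<open>k \<noteq> k'\<close>] by simp
      then show ?thesis by simp
    qed
    finally show "(\<Sum>q\<in>J. character (\<beta> q) (int_vec (a - b))) = 0" .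
  qed
  then show ?thesis by blast
qed

section \<open>The counterexample\<close>

theorem theorem1p2:
  assumes "CARD('n::finite) \<ge> 5"
  shows "(\<exists>\<Omega> :: (real ^ 'n) set. compact \<Omega> \<and> measure lebesgue \<Omega> > 0 \<and>
            (\<exists>\<Lambda>. is_spectrum \<Lambda> \<Omega>) \<and> \<not> tiles_by_translations \<Omega>) \<and>
         \<not> fuglede_conjecture TYPE('n)"
proof -
  obtain I :: "'n set" where I: "card I = 5"
    using obtain_subset_with_card_n[OF assms] by blast
  define A where "A = thick_simplex I (6 ^ CARD('n))"
  define \<Omega> where "\<Omega> = cube_union A"
  have A: "finite A" "A \<noteq> {}"
    by (simp_all add: A_def finite_thick_simplex thick_simplex_nonempty)
  have "compact \<Omega>" using A by (simp add: \<Omega>_def compact_cube_union)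
  moreover have pos: "measure lebesgue \<Omega> > 0"
    using A by (simp add: \<Omega>_def measure_cube_union card_gt_0_iff)
  moreover have spec: "\<exists>\<Lambda>. is_spectrum \<Lambda> \<Omega>"
    unfolding \<Omega>_def A_def by (rule spectral_thick_simplex[OF I]) simp
  moreover have not_tile: "\<not> tiles_by_translations \<Omega>"
  proof
    assume "tiles_by_translations \<Omega>"
    then have "\<exists>S. \<forall>y. \<exists>!s. s \<in> S \<and> y - s \<in> A"
      unfolding \<Omega>_def by (rule lattice_tiling_of_tiling[OF A])
    moreover have "odd (3 ^ CARD('n) :: nat)" by simp
    then have "\<not> Suc (card I) dvd 3 ^ CARD('n)"
      using dvd_trans[of 2 6 "3 ^ CARD('n) :: nat"] I by auto
    ultimately show False
      using no_lattice_tiling_thick_simplex[of I "6 ^ CARD('n)"] by (simp add: A_def)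
  qed
  moreover have "fuglede_domain \<Omega>"
    using pos A by (simp add: fuglede_domain_def \<Omega>_def cube_union_lmeasurable)
  then have "\<not> fuglede_conjecture TYPE('n)"
    using spec not_tile unfolding fuglede_conjecture_def by blast
  ultimately show ?thesis by blast
qed

end
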